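(* For all integers $0\le k\le n$: $E^B_{n,k}(-1)=\binom nk$; $E^B_{n,k}(0)=\binom nk^2$; $E^B_{n,k}(1)$ equals the type $B$ Eulerian number $\#\{\pi\in B_n:\operatorname{des}_B(\pi)=k\}$; and $E^B_{n,k}(q)=E^B_{n,n-k}(q)$ as polynomials in $q$.
   Context: $B_n$ is the set of signed permutations $\pi=\pi_1\cdots\pi_n$ of $[n]$ (words of nonzero integers with $|\pi_1|\cdots|\pi_n|$ a permutation of $[n]$). Let $\operatorname{wex}(\pi)=\#\{i:\pi_i\ge i\}$, $\operatorname{neg}(\pi)=\#\{i:\pi_i<0\}$, $\operatorname{fwex}(\pi)=2\operatorname{wex}(\pi)+\operatorname{neg}(\pi)$, and $\operatorname{des}_B(\pi)=\#\{i\in\{0,\dots,n-1\}:\pi_i>\pi_{i+1}\}$ with $\pi_0=0$. A crossing of $\pi$ is a pair $(i,j)$ with $i,j\in[n]$ such that $i<j\le\pi_i<\pi_j$, or $-i<j\le-\pi_i<\pi_j$, or $i>j>\pi_i>\pi_j$; $\operatorname{cro}(\pi)$ is their number. Define $E^B_{n,k}(q)=\sum_{\pi\in B_n,\ \lfloor\operatorname{fwex}(\pi)/2\rfloor=k} q^{\operatorname{cro}(\pi)}$. *)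

theory Defs
  imports "HOL-Computational_Algebra.Polynomial"
begin

text \<open>
  The word \<open>\<pi>\<^sub>1 \<dots> \<pi>\<^sub>n\<close> is the function \<open>i \<mapsto> \<pi>\<^sub>i\<close>, extended by \<open>0\<close> outside \<open>{1..n}\<close>; this makes the
  representation unique and includes the convention \<open>\<pi>\<^sub>0 = 0\<close>. The letters are automatically
  nonzero, since \<open>\<bar>\<pi>\<^sub>i\<bar> \<in> {1..n}\<close>.
\<close>
definition signed_perms :: "nat \<Rightarrow> (nat \<Rightarrow> int) set" where
  "signed_perms n =
    {\<pi>. bij_betw (\<lambda>i. \<bar>\<pi> i\<bar>) {1..n} {1..int n} \<and> (\<forall>i. i \<notin> {1..n} \<longrightarrow> \<pi> i = 0)}"

definition wex :: "nat \<Rightarrow> (nat \<Rightarrow> int) \<Rightarrow> nat" where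
  "wex n \<pi> = card {i \<in> {1..n}. \<pi> i \<ge> int i}"

definition neg :: "nat \<Rightarrow> (nat \<Rightarrow> int) \<Rightarrow> nat" where
  "neg n \<pi> = card {i \<in> {1..n}. \<pi> i < 0}"

definition fwex :: "nat \<Rightarrow> (nat \<Rightarrow> int) \<Rightarrow> nat" where
  "fwex n \<pi> = 2 * wex n \<pi> + neg n \<pi>"

definition des_B :: "nat \<Rightarrow> (nat \<Rightarrow> int) \<Rightarrow> nat" where
  "des_B n \<pi> = card {i \<in> {0..<n}. \<pi> i > \<pi> (Suc i)}"

definition is_crossing :: "(nat \<Rightarrow> int) \<Rightarrow> nat \<Rightarrow> nat \<Rightarrow> bool" where
  "is_crossing \<pi> i j \<longleftrightarrow>
     (int i < int j \<and> int j \<le> \<pi> i \<and> \<pi> i < \<pi> j) \<or>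
     (- int i < int j \<and> int j \<le> - \<pi> i \<and> - \<pi> i < \<pi> j) \<or>
     (int i > int j \<and> int j > \<pi> i \<and> \<pi> i > \<pi> j)"

definition cro :: "nat \<Rightarrow> (nat \<Rightarrow> int) \<Rightarrow> nat" where
  "cro n \<pi> = card {(i, j). i \<in> {1..n} \<and> j \<in> {1..n} \<and> is_crossing \<pi> i j}"

definition E_B :: "nat \<Rightarrow> nat \<Rightarrow> int poly" where
  "E_B n k = (\<Sum>\<pi> \<in> {\<pi> \<in> signed_perms n. fwex n \<pi> div 2 = k}. monom 1 (cro n \<pi>))"

definition eulerian_B :: "nat \<Rightarrow> nat \<Rightarrow> nat" where
  "eulerian_B n k = card {\<pi> \<in> signed_perms n. des_B n \<pi> = k}"

end

theory Submission
  imports Defs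
begin

text \<open>
  Deleting a letter and standardising the rest removes the positions \<open>n, n - 1, \<dots>\<close> and the values
  \<open>n, n - 1, \<dots>\<close> alternately. The intermediate objects are the signed permutations of \<open>[N]\<close> with
  \<open>\<pi>\<^sub>i \<le> r\<close> for all \<open>i > p\<close>, where \<open>p\<close> and \<open>r\<close> differ by at most one; on them the number of crossings
  lost depends only on the deleted letter, which gives \<open>q\<close>-integers as weights. The result is
  \<open>\<Sum>\<^sub>\<pi> y\<^bsup>fwex \<pi>\<^esup> q\<^bsup>cro \<pi>\<^esup> = y (1 + y) c\<^sub>n\<^sub>-\<^sub>1(0)\<close> over \<open>B\<^sub>n\<close>, with \<open>c\<^sub>0 = 1\<close> and
  \<open>c\<^sub>n\<^sub>+\<^sub>1(h) = y[h+2]c\<^sub>n(h+1) + (1+y\<^sup>2)[h+1]c\<^sub>n(h) + y[h]c\<^sub>n(h-1)\<close>, so \<open>E\<^sup>B\<^sub>n\<^sub>,\<^sub>k\<close> is the coefficient of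
  \<open>y\<^bsup>2k\<^esup>\<close> in \<open>(1+y)\<^sup>2 c\<^sub>n\<^sub>-\<^sub>1(0)\<close>.
  Each \<open>c\<^sub>n(h)\<close> is palindromic in \<open>y\<close>, whence the symmetry. At \<open>q = -1\<close> the weight \<open>[2]\<close> vanishes and
  \<open>c\<^sub>n(0) = (1+y\<^sup>2)\<^sup>n\<close>. At \<open>q = 0\<close> the recurrence is solved by the reflection principle. At \<open>q = 1\<close> it
  implies the recurrence of the type B Eulerian numbers, which in turn is obtained by inserting
  the letters \<open>\<plusminus>(n+1)\<close>.
\<close>

section \<open>Inserting and deleting a letter\<close>

text \<open>Depends on \<open>v\<close> only through its absolute value: both v and -v are freed at
  once and signs are kept. For v \<noteq> 0 the filler letter 0 stays fixed.\<close>

definition lift :: "int \<Rightarrow> int \<Rightarrow> int" where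
  "lift v w = (if w \<ge> \<bar>v\<bar> then w + 1 else if w \<le> - \<bar>v\<bar> then w - 1 else w)"

definition lower :: "int \<Rightarrow> int \<Rightarrow> int" where
  "lower v w = (if w > \<bar>v\<bar> then w - 1 else if w < - \<bar>v\<bar> then w + 1 else w)"

text \<open>The increasing enumeration of the positions other than i. Being total on the naturals,
  it lets every position be split into i or some \<open>skip i j\<close>.\<close>

definition skip :: "nat \<Rightarrow> nat \<Rightarrow> nat" where
  "skip i j = (if j < i then j else Suc j)"

definition insert_letter :: "nat \<Rightarrow> int \<Rightarrow> (nat \<Rightarrow> int) \<Rightarrow> nat \<Rightarrow> int" where
  "insert_letter i v \<pi> j =
     (if j < i then lift v (\<pi> j) else if j = i then v else lift v (\<pi> (j - 1)))"

definition delete_letter :: "nat \<Rightarrow> int \<Rightarrow> (nat \<Rightarrow> int) \<Rightarrow> nat \<Rightarrow> int" where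
  "delete_letter i v \<pi> j = lower v (\<pi> (skip i j))"

text \<open>An injection between two sets of size n is onto, so surjectivity need not be checked for
  words built by insertion or deletion.\<close>

lemma signed_perms_iff:
  "\<pi> \<in> signed_perms n \<longleftrightarrow>
     inj_on (\<lambda>i. \<bar>\<pi> i\<bar>) {1..n} \<and> (\<forall>i\<in>{1..n}. 1 \<le> \<bar>\<pi> i\<bar> \<and> \<bar>\<pi> i\<bar> \<le> int n) \<and> (\<forall>i. i \<notin> {1..n} \<longrightarrow> \<pi> i = 0)"
proof
  assume "\<pi> \<in> signed_perms n"
  then show "inj_on (\<lambda>i. \<bar>\<pi> i\<bar>) {1..n} \<and> (\<forall>i\<in>{1..n}. 1 \<le> \<bar>\<pi> i\<bar> \<and> \<bar>\<pi> i\<bar> \<le> int n) \<and> (\<forall>i. i \<notin> {1..n} \<longrightarrow> \<pi> i = 0)"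
    by (auto simp: signed_perms_def bij_betw_def)
next
  assume a: "inj_on (\<lambda>i. \<bar>\<pi> i\<bar>) {1..n} \<and> (\<forall>i\<in>{1..n}. 1 \<le> \<bar>\<pi> i\<bar> \<and> \<bar>\<pi> i\<bar> \<le> int n) \<and> (\<forall>i. i \<notin> {1..n} \<longrightarrow> \<pi> i = 0)"
  then have "(\<lambda>i. \<bar>\<pi> i\<bar>) ` {1..n} = {1..int n}"
    by (intro card_subset_eq) (auto simp: card_image)
  with a show "\<pi> \<in> signed_perms n"
    by (simp add: signed_perms_def bij_betw_def)
qed

lemma signed_perms_outside: "\<pi> \<in> signed_perms n \<Longrightarrow> i = 0 \<or> n < i \<Longrightarrow> \<pi> i = 0"
  by (auto simp: signed_perms_def)

lemma signed_perms_bounds: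
  "\<pi> \<in> signed_perms n \<Longrightarrow> 1 \<le> i \<Longrightarrow> i \<le> n \<Longrightarrow> \<pi> i \<noteq> 0 \<and> \<pi> i \<le> int n \<and> - int n \<le> \<pi> i"
  by (force simp: signed_perms_iff)

lemma signed_perms_upper: "\<pi> \<in> signed_perms n \<Longrightarrow> \<pi> i \<le> int n"
  using signed_perms_bounds[of \<pi> n i] signed_perms_outside[of \<pi> n i] by force

lemma signed_perms_inj:
  "\<pi> \<in> signed_perms n \<Longrightarrow> 1 \<le> i \<Longrightarrow> i \<le> n \<Longrightarrow> 1 \<le> j \<Longrightarrow> j \<le> n \<Longrightarrow> \<bar>\<pi> i\<bar> = \<bar>\<pi> j\<bar> \<Longrightarrow> i = j"
  using inj_onD[of "\<lambda>i. \<bar>\<pi> i\<bar>" "{1..n}" i j] by (simp add: signed_perms_iff)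

lemma signed_perms_obtain:
  assumes "\<pi> \<in> signed_perms n" "1 \<le> w" "w \<le> int n"
  obtains i where "1 \<le> i" "i \<le> n" "\<bar>\<pi> i\<bar> = w"
proof -
  have "w \<in> (\<lambda>i. \<bar>\<pi> i\<bar>) ` {1..n}"
    using assms by (simp add: signed_perms_def bij_betw_def)
  then show thesis using that by auto
qed

lemma insert_letter_at [simp]: "insert_letter i v \<pi> i = v"
  by (simp add: insert_letter_def)

lemma insert_letter_skip: "insert_letter i v \<pi> (skip i j) = lift v (\<pi> j)"
  by (auto simp: insert_letter_def skip_def)

lemma skip_neq: "skip i j \<noteq> i"
  by (auto simp: skip_def)

lemma skip_inj [simp]: "skip i j = skip i j' \<longleftrightarrow> j = j'"
  by (auto simp: skip_def split: if_splits)

lemma skip_cases: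
  obtains "j = i" | j' where "j = skip i j'"
proof (cases "j < i")
  case True then show ?thesis using that(2)[of j] by (simp add: skip_def)
next
  case False then show ?thesis using that(1) that(2)[of "j - 1"] by (cases "j = i") (auto simp: skip_def)
qed

lemma skip_range:
  assumes "1 \<le> i" "i \<le> Suc n"
  shows "1 \<le> skip i j \<and> skip i j \<le> Suc n \<longleftrightarrow> 1 \<le> j \<and> j \<le> n"
  using assms by (auto simp: skip_def)

lemma abs_lift: "v \<noteq> 0 \<Longrightarrow> \<bar>lift v w\<bar> = (if \<bar>v\<bar> \<le> \<bar>w\<bar> then \<bar>w\<bar> + 1 else \<bar>w\<bar>)"
  by (auto simp: lift_def)

lemma abs_lift_neq: "v \<noteq> 0 \<Longrightarrow> \<bar>lift v w\<bar> \<noteq> \<bar>v\<bar>"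
  by (auto simp: lift_def)

lemma abs_lift_eq_iff: "v \<noteq> 0 \<Longrightarrow> \<bar>lift v w\<bar> = \<bar>lift v w'\<bar> \<longleftrightarrow> \<bar>w\<bar> = \<bar>w'\<bar>"
  by (auto simp: abs_lift)

lemma lower_lift [simp]: "v \<noteq> 0 \<Longrightarrow> lower v (lift v w) = w"
  by (auto simp: lower_def lift_def)

lemma lift_lower: "v \<noteq> 0 \<Longrightarrow> \<bar>w\<bar> \<noteq> \<bar>v\<bar> \<Longrightarrow> lift v (lower v w) = w"
  by (auto simp: lower_def lift_def)

lemma abs_lower: "v \<noteq> 0 \<Longrightarrow> \<bar>lower v w\<bar> = (if \<bar>v\<bar> < \<bar>w\<bar> then \<bar>w\<bar> - 1 else \<bar>w\<bar>)"
  by (auto simp: lower_def)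

lemma insert_letter_in_signed_perms:
  assumes "\<pi> \<in> signed_perms n" "1 \<le> i" "i \<le> Suc n" "v \<noteq> 0" "\<bar>v\<bar> \<le> int (Suc n)"
  shows "insert_letter i v \<pi> \<in> signed_perms (Suc n)"
  unfolding signed_perms_iff
proof (intro conjI ballI allI impI)
  show "inj_on (\<lambda>j. \<bar>insert_letter i v \<pi> j\<bar>) {1..Suc n}"
  proof (rule inj_onI)
    fix a b assume ab: "a \<in> {1..Suc n}" "b \<in> {1..Suc n}"
      "\<bar>insert_letter i v \<pi> a\<bar> = \<bar>insert_letter i v \<pi> b\<bar>"
    show "a = b"
    proof (cases a i rule: skip_cases)
      case 1
      then show ?thesis using ab abs_lift_neq[OF assms(4)]
        by (cases b i rule: skip_cases) (auto simp: insert_letter_skip eq_commute[of "\<bar>v\<bar>"])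
    next
      case (2 a')
      show ?thesis
      proof (cases b i rule: skip_cases)
        case 1
        then show ?thesis using ab 2 abs_lift_neq[OF assms(4)] by (auto simp: insert_letter_skip)
      next
        case (2 b')
        with \<open>a = skip i a'\<close> ab show ?thesis
          using assms skip_range[OF assms(2,3)] signed_perms_inj[OF assms(1), of a' b']
          by (auto simp: insert_letter_skip abs_lift_eq_iff)
      qed
    qed
  qed
next
  fix a assume "a \<in> {1..Suc n}"
  then have "\<bar>insert_letter i v \<pi> a\<bar> \<ge> 1 \<and> \<bar>insert_letter i v \<pi> a\<bar> \<le> int (Suc n)"
    using assms skip_range[OF assms(2,3)] signed_perms_bounds[OF assms(1)]
    by (cases a i rule: skip_cases) (force simp: insert_letter_skip abs_lift)+
  then show "\<bar>insert_letter i v \<pi> a\<bar> \<ge> 1" "\<bar>insert_letter i v \<pi> a\<bar> \<le> int (Suc n)" by auto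
next
  fix a assume a: "a \<notin> {1..Suc n}"
  show "insert_letter i v \<pi> a = 0"
  proof (cases a i rule: skip_cases)
    case 1 with a assms show ?thesis by auto
  next
    case (2 a')
    then have "a' = 0 \<or> n < a'" using a skip_range[OF assms(2,3), of a'] by auto
    then show ?thesis using assms(4) signed_perms_outside[OF assms(1), of a'] 2
      by (simp add: insert_letter_skip lift_def)
  qed
qed

lemma delete_letter_in_signed_perms:
  assumes "\<pi> \<in> signed_perms (Suc n)" "1 \<le> i" "i \<le> Suc n" "\<pi> i = v"
  shows "delete_letter i v \<pi> \<in> signed_perms n" "insert_letter i v (delete_letter i v \<pi>) = \<pi>"
proof -
  have v: "v \<noteq> 0" "\<bar>v\<bar> \<le> int (Suc n)" using assms signed_perms_bounds[OF assms(1-3)] by auto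
  \<comment> \<open>Only where the absolute value of v is avoided does \<open>lift v\<close> undo
    \<open>lower v\<close>. Inside the range this is injectivity; outside it the letter is 0 while v
    is not.\<close>
  have neq: "\<bar>\<pi> (skip i j)\<bar> \<noteq> \<bar>v\<bar>" for j
  proof (cases "1 \<le> j \<and> j \<le> n")
    case True
    then show ?thesis using assms skip_range[OF assms(2,3), of j] skip_neq[of i j]
        signed_perms_inj[OF assms(1), of "skip i j" i] by auto
  next
    case False
    then have "\<pi> (skip i j) = 0"
      using skip_range[OF assms(2,3), of j] signed_perms_outside[OF assms(1), of "skip i j"] by auto
    then show ?thesis using v by auto
  qed
  show ins: "insert_letter i v (delete_letter i v \<pi>) = \<pi>"
  proof
    fix j show "insert_letter i v (delete_letter i v \<pi>) j = \<pi> j"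
      using assms(4) neq v by (cases j i rule: skip_cases)
        (auto simp: insert_letter_skip delete_letter_def lift_lower)
  qed
  show "delete_letter i v \<pi> \<in> signed_perms n"
    unfolding signed_perms_iff
  proof (intro conjI ballI allI impI)
    show "inj_on (\<lambda>j. \<bar>delete_letter i v \<pi> j\<bar>) {1..n}"
    proof (rule inj_onI)
      fix a b assume ab: "a \<in> {1..n}" "b \<in> {1..n}" "\<bar>delete_letter i v \<pi> a\<bar> = \<bar>delete_letter i v \<pi> b\<bar>"
      then have "\<bar>\<pi> (skip i a)\<bar> = \<bar>\<pi> (skip i b)\<bar>"
        using neq[of a] neq[of b] v by (auto simp: delete_letter_def abs_lower split: if_splits)
      then show "a = b" using ab skip_range[OF assms(2,3)] signed_perms_inj[OF assms(1), of "skip i a" "skip i b"] by auto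
    qed
  next
    fix a assume "a \<in> {1..n}"
    then have "\<pi> (skip i a) \<noteq> 0 \<and> \<bar>\<pi> (skip i a)\<bar> \<le> int (Suc n)"
      using skip_range[OF assms(2,3), of a] signed_perms_bounds[OF assms(1), of "skip i a"] by auto
    then show "1 \<le> \<bar>delete_letter i v \<pi> a\<bar>" "\<bar>delete_letter i v \<pi> a\<bar> \<le> int n"
      using neq[of a] v by (auto simp: delete_letter_def abs_lower)
  next
    fix a assume "a \<notin> {1..n}"
    then have "\<pi> (skip i a) = 0"
      using skip_range[OF assms(2,3), of a] signed_perms_outside[OF assms(1), of "skip i a"] by auto
    then show "delete_letter i v \<pi> a = 0" by (simp add: delete_letter_def lower_def)
  qed
qed

lemma insert_letter_inj: "v \<noteq> 0 \<Longrightarrow> inj (insert_letter i v)"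
proof (rule injI, rule ext)
  fix \<pi> \<rho> :: "nat \<Rightarrow> int" and j
  assume v: "v \<noteq> 0" and "insert_letter i v \<pi> = insert_letter i v \<rho>"
  then have "lift v (\<pi> j) = lift v (\<rho> j)" by (metis insert_letter_skip)
  then show "\<pi> j = \<rho> j" using v by (metis lower_lift)
qed

lemma insert_letter_image:
  assumes "1 \<le> i" "i \<le> Suc n" "v \<noteq> 0" "\<bar>v\<bar> \<le> int (Suc n)"
  shows "insert_letter i v ` signed_perms n = {\<pi> \<in> signed_perms (Suc n). \<pi> i = v}"
proof (intro equalityI subsetI)
  fix \<pi> assume "\<pi> \<in> insert_letter i v ` signed_perms n"
  then obtain \<rho> where "\<rho> \<in> signed_perms n" "\<pi> = insert_letter i v \<rho>" by blast
  then show "\<pi> \<in> {\<pi> \<in> signed_perms (Suc n). \<pi> i = v}"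
    using insert_letter_in_signed_perms[OF _ assms, of \<rho>] by simp
next
  fix \<pi> assume "\<pi> \<in> {\<pi> \<in> signed_perms (Suc n). \<pi> i = v}"
  then have p: "\<pi> \<in> signed_perms (Suc n)" "\<pi> i = v" by auto
  note del = delete_letter_in_signed_perms[OF p(1) assms(1,2) p(2)]
  show "\<pi> \<in> insert_letter i v ` signed_perms n"
    by (rule image_eqI[where x = "delete_letter i v \<pi>"]) (simp_all only: del)
qed

lemma signed_perms_0: "signed_perms 0 = {\<lambda>_. 0}"
  by (auto simp: signed_perms_iff)

lemma finite_signed_perms: "finite (signed_perms n)"
proof (induction n)
  case (Suc n)
  \<comment> \<open>The first letter has finitely many possible values, and deleting it leads back
    to length n.\<close>
  have "signed_perms (Suc n) \<subseteq> (\<Union>v\<in>{- int (Suc n)..int (Suc n)}. insert_letter 1 v ` signed_perms n)"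
  proof
    fix \<pi> assume p: "\<pi> \<in> signed_perms (Suc n)"
    from signed_perms_bounds[OF p, of 1] have b: "\<pi> 1 \<noteq> 0" "\<bar>\<pi> 1\<bar> \<le> int (Suc n)" by auto
    have "\<pi> \<in> insert_letter 1 (\<pi> 1) ` signed_perms n"
      by (subst insert_letter_image) (use p b in auto)
    with b show "\<pi> \<in> (\<Union>v\<in>{- int (Suc n)..int (Suc n)}. insert_letter 1 v ` signed_perms n)"
      by (intro UN_I[of "\<pi> 1"]) auto
  qed
  then show ?case by (rule finite_subset) (use Suc in auto)
qed (simp add: signed_perms_0)

section \<open>Crossings and insertion\<close>

lemma skip_image:
  assumes "1 \<le> i" "i \<le> Suc n"
  shows "{1..Suc n} = insert i (skip i ` {1..n})"
proof (intro equalityI subsetI)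
  fix a assume a: "a \<in> {1..Suc n}"
  show "a \<in> insert i (skip i ` {1..n})"
  proof (cases a i rule: skip_cases)
    case (2 j)
    then show ?thesis using a skip_range[OF assms, of j] by auto
  qed simp
next
  fix a assume "a \<in> insert i (skip i ` {1..n})"
  then consider "a = i" | j where "a = skip i j" "1 \<le> j" "j \<le> n" by auto
  then show "a \<in> {1..Suc n}"
  proof cases
    case (2 j)
    then show ?thesis using skip_range[OF assms, of j] by auto
  qed (use assms in simp)
qed

lemma card_skip:
  assumes "1 \<le> i" "i \<le> Suc n"
  shows "card {j \<in> {1..Suc n}. P j} = card {j \<in> {1..n}. P (skip i j)} + (if P i then 1 else 0)"
proof -
  have "{j \<in> {1..Suc n}. P j} = skip i ` {j \<in> {1..n}. P (skip i j)} \<union> (if P i then {i} else {})"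
    unfolding skip_image[OF assms] by auto
  moreover have "card (skip i ` {j \<in> {1..n}. P (skip i j)} \<union> (if P i then {i} else {})) =
      card (skip i ` {j \<in> {1..n}. P (skip i j)}) + card (if P i then {i} else {})"
    by (intro card_Un_disjoint) (auto simp: skip_neq skip_neq[symmetric])
  ultimately show ?thesis by (simp add: card_image inj_on_def)
qed

lemma neg_insert_letter:
  assumes "1 \<le> i" "i \<le> Suc n"
  shows "neg (Suc n) (insert_letter i v \<pi>) = neg n \<pi> + (if v < 0 then 1 else 0)"
proof -
  have "lift v w < 0 \<longleftrightarrow> w < 0" for w by (auto simp: lift_def)
  then show ?thesis unfolding neg_def card_skip[OF assms] by (simp add: insert_letter_skip)
qed

lemma wex_insert_letter:
  assumes "1 \<le> i" "i \<le> Suc n"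
    and "\<And>j. 1 \<le> j \<Longrightarrow> j \<le> n \<Longrightarrow> int (skip i j) \<le> lift v (\<pi> j) \<longleftrightarrow> int j \<le> \<pi> j"
  shows "wex (Suc n) (insert_letter i v \<pi>) = wex n \<pi> + (if int i \<le> v then 1 else 0)"
proof -
  have "{j \<in> {1..n}. int (skip i j) \<le> lift v (\<pi> j)} = {j \<in> {1..n}. int j \<le> \<pi> j}"
    using assms(3) by auto
  then show ?thesis unfolding wex_def card_skip[OF assms(1,2)] by (simp add: insert_letter_skip)
qed

lemma is_crossing_irrefl: "\<not> is_crossing \<pi> i i"
  by (auto simp: is_crossing_def)

text \<open>A new crossing has the inserted position as its first or as its second entry, never
  both. That the old pairs keep their status depends on the letter, so it is a hypothesis, to be
  checked for each kind of insertion.\<close>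

lemma cro_insert_letter:
  assumes i: "1 \<le> i" "i \<le> Suc n"
    and "\<And>a b. 1 \<le> a \<Longrightarrow> a \<le> n \<Longrightarrow> 1 \<le> b \<Longrightarrow> b \<le> n \<Longrightarrow>
      is_crossing (insert_letter i v \<pi>) (skip i a) (skip i b) \<longleftrightarrow> is_crossing \<pi> a b"
  shows "cro (Suc n) (insert_letter i v \<pi>) = cro n \<pi> +
    card {b \<in> {1..Suc n}. is_crossing (insert_letter i v \<pi>) i b} +
    card {a \<in> {1..Suc n}. is_crossing (insert_letter i v \<pi>) a i}"
proof -
  let ?\<sigma> = "insert_letter i v \<pi>"
  let ?O = "{(a, b). a \<in> {1..n} \<and> b \<in> {1..n} \<and> is_crossing \<pi> a b}"
  let ?X = "{b \<in> {1..Suc n}. is_crossing ?\<sigma> i b}"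
  let ?Y = "{a \<in> {1..Suc n}. is_crossing ?\<sigma> a i}"
  have O: "map_prod (skip i) (skip i) ` ?O \<subseteq> {(a, b). a \<in> {1..Suc n} \<and> b \<in> {1..Suc n} \<and> is_crossing ?\<sigma> a b}"
  proof
    fix p assume "p \<in> map_prod (skip i) (skip i) ` ?O"
    then obtain a b where "p = (skip i a, skip i b)" "1 \<le> a" "a \<le> n" "1 \<le> b" "b \<le> n" "is_crossing \<pi> a b"
      by auto
    then show "p \<in> {(a, b). a \<in> {1..Suc n} \<and> b \<in> {1..Suc n} \<and> is_crossing ?\<sigma> a b}"
      using assms(3)[of a b] skip_range[OF i, of a] skip_range[OF i, of b] by simp
  qed
  have "{(a, b). a \<in> {1..Suc n} \<and> b \<in> {1..Suc n} \<and> is_crossing ?\<sigma> a b} =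
      map_prod (skip i) (skip i) ` ?O \<union> ({i} \<times> ?X \<union> ?Y \<times> {i})" (is "?L = ?R")
  proof (intro equalityI subsetI)
    fix p assume p: "p \<in> ?L"
    obtain a b where ab: "p = (a, b)" by fastforce
    show "p \<in> ?R"
    proof (cases a i rule: skip_cases)
      case 1 then show ?thesis using p ab by auto
    next
      case a: (2 a')
      show ?thesis
      proof (cases b i rule: skip_cases)
        case 1 then show ?thesis using p ab by auto
      next
        case b: (2 b')
        have "1 \<le> a'" "a' \<le> n" "1 \<le> b'" "b' \<le> n"
          using p ab a b skip_range[OF i, of a'] skip_range[OF i, of b'] by auto
        then have "(a', b') \<in> ?O" using assms(3)[of a' b'] p ab a b by auto
        then show ?thesis using ab a b by (intro UnI1 image_eqI[of _ _ "(a', b')"]) auto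
      qed
    qed
  next
    fix p assume "p \<in> ?R"
    then consider "p \<in> map_prod (skip i) (skip i) ` ?O" | "p \<in> {i} \<times> ?X" | "p \<in> ?Y \<times> {i}" by blast
    then show "p \<in> ?L"
    proof cases
      case 1 then show ?thesis using O by blast
    qed (use i in auto)
  qed
  moreover have "finite ?O" by (rule finite_subset[of _ "{1..n} \<times> {1..n}"]) auto
  moreover have "map_prod (skip i) (skip i) ` ?O \<inter> ({i} \<times> ?X \<union> ?Y \<times> {i}) = {}"
    using skip_neq by auto
  moreover have "({i} \<times> ?X) \<inter> (?Y \<times> {i}) = {}" using is_crossing_irrefl[of ?\<sigma> i] by auto
  moreover have "inj (map_prod (skip i) (skip i))" by (auto simp: inj_def)
  ultimately show ?thesis unfolding cro_def
    by (simp add: card_Un_disjoint card_image inj_on_subset[OF _ subset_UNIV] card_cartesian_product)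
qed

section \<open>Words with bounded tail and the three kinds of insertion\<close>

definition bounded_tail :: "nat \<Rightarrow> nat \<Rightarrow> nat \<Rightarrow> (nat \<Rightarrow> int) set" where
  "bounded_tail n p r = {\<pi> \<in> signed_perms n. \<forall>i>p. \<pi> i \<le> int r}"

text \<open>Crossings with an inserted letter will be characterised by an interval of absolute
  values; since every absolute value occurs once, their number is the length of the
  interval.\<close>

lemma card_values:
  assumes "\<pi> \<in> signed_perms n" "lo \<ge> 1" "hi \<le> int n"
  shows "card {a \<in> {1..n}. lo \<le> \<bar>\<pi> a\<bar> \<and> \<bar>\<pi> a\<bar> \<le> hi} = nat (hi + 1 - lo)"
proof -
  have "bij_betw (\<lambda>a. \<bar>\<pi> a\<bar>) {a \<in> {1..n}. lo \<le> \<bar>\<pi> a\<bar> \<and> \<bar>\<pi> a\<bar> \<le> hi} {lo..hi}"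
  proof (rule bij_betw_imageI)
    show "inj_on (\<lambda>a. \<bar>\<pi> a\<bar>) {a \<in> {1..n}. lo \<le> \<bar>\<pi> a\<bar> \<and> \<bar>\<pi> a\<bar> \<le> hi}"
      using assms(1) by (auto simp: signed_perms_iff intro: inj_on_subset)
    show "(\<lambda>a. \<bar>\<pi> a\<bar>) ` {a \<in> {1..n}. lo \<le> \<bar>\<pi> a\<bar> \<and> \<bar>\<pi> a\<bar> \<le> hi} = {lo..hi}"
    proof (intro equalityI subsetI)
      fix w assume w: "w \<in> {lo..hi}"
      then obtain a where "1 \<le> a" "a \<le> n" "\<bar>\<pi> a\<bar> = w"
        using signed_perms_obtain[OF assms(1), of w] assms by auto
      then show "w \<in> (\<lambda>a. \<bar>\<pi> a\<bar>) ` {a \<in> {1..n}. lo \<le> \<bar>\<pi> a\<bar> \<and> \<bar>\<pi> a\<bar> \<le> hi}"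
        using w by auto
    qed auto
  qed
  then show ?thesis using bij_betw_same_card by fastforce
qed

text \<open>The new letter m+1 lies below its position i, so it adds nothing to \<open>fwex\<close>.
  Its crossings are of the third kind: every position strictly between m+1 and i carries a letter at
  most m and is crossed by i.\<close>

lemma lower_insertion:
  assumes \<pi>: "\<pi> \<in> bounded_tail n (Suc m) m" and i: "Suc m < i" "i \<le> Suc n"
  defines "\<sigma> \<equiv> insert_letter i (int (Suc m)) \<pi>"
  shows "cro (Suc n) \<sigma> = cro n \<pi> + (i - Suc (Suc m))" "fwex (Suc n) \<sigma> = fwex n \<pi>"
    "\<sigma> \<in> bounded_tail (Suc n) (Suc m) (Suc m)"
proof -
  have sp: "\<pi> \<in> signed_perms n" and tail: "\<And>a. a > Suc m \<Longrightarrow> \<pi> a \<le> int m"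
    using \<pi> by (auto simp: bounded_tail_def)
  have i1: "1 \<le> i" using i by simp
  have sps: "\<sigma> \<in> signed_perms (Suc n)"
    unfolding \<sigma>_def using i by (intro insert_letter_in_signed_perms[OF sp]) auto
  have tails: "\<sigma> a \<le> int m" if "a > Suc m" "a \<noteq> i" for a
  proof (cases a i rule: skip_cases)
    case (2 j)
    with that i have "j > Suc m" by (auto simp: skip_def split: if_splits)
    with 2 tail[of j] show ?thesis by (auto simp: \<sigma>_def insert_letter_skip lift_def)
  qed (use that in simp)
  then have "\<sigma> a \<le> int (Suc m)" if "a > Suc m" for a
    using that unfolding \<sigma>_def by (cases "a = i") force+
  then show "\<sigma> \<in> bounded_tail (Suc n) (Suc m) (Suc m)" using sps by (simp add: bounded_tail_def)
  \<comment> \<open>Letters above m occur only at positions up to m+1, which stay put while those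
    letters rise. Positions from i on move, but carry letters at most m, which do not rise. Hence
    comparisons of letters with positions survive.\<close>
  have tail': "a \<le> Suc m \<or> \<pi> a \<le> int m" for a using tail[of a] by linarith
  have wx: "int (skip i j) \<le> lift (int (Suc m)) (\<pi> j) \<longleftrightarrow> int j \<le> \<pi> j" for j
    using tail'[of j] i by (auto simp: skip_def lift_def)
  have cr: "is_crossing \<sigma> (skip i a) (skip i b) \<longleftrightarrow> is_crossing \<pi> a b" for a b
    using tail'[of a] tail'[of b] i unfolding \<sigma>_def is_crossing_def insert_letter_skip
    by (auto simp: skip_def lift_def)
  have "{b \<in> {1..Suc n}. is_crossing \<sigma> i b} = {Suc (Suc m)..<i}"
  proof -
    have "is_crossing \<sigma> i b \<longleftrightarrow> Suc m < b \<and> b < i" if "b \<in> {1..Suc n}" for b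
      using i tails[of b] that unfolding is_crossing_def by (auto simp: \<sigma>_def)
    then show ?thesis using i by auto
  qed
  moreover have "{a \<in> {1..Suc n}. is_crossing \<sigma> a i} = {}"
  proof -
    have "\<not> is_crossing \<sigma> a i" for a
      using i tails[of a] unfolding is_crossing_def by (auto simp: \<sigma>_def)
    then show ?thesis by auto
  qed
  ultimately show "cro (Suc n) \<sigma> = cro n \<pi> + (i - Suc (Suc m))"
    using cro_insert_letter[OF i1 i(2), of "int (Suc m)" \<pi>] cr unfolding \<sigma>_def by simp
  show "fwex (Suc n) \<sigma> = fwex n \<pi>"
    unfolding fwex_def \<sigma>_def using i wx neg_insert_letter[OF i1 i(2)]
    by (subst wex_insert_letter[OF i1 i(2)]) auto
qed

text \<open>The new letter is a weak excedance at position m+1, hence the 2. It is crossed exactly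
  by the letters of absolute value between m+1 and v-1, and it crosses nothing, since all later
  letters are at most m.\<close>

lemma upper_insertion:
  assumes \<pi>: "\<pi> \<in> bounded_tail n m m" and v: "m < v" "v \<le> Suc n"
  defines "\<sigma> \<equiv> insert_letter (Suc m) (int v) \<pi>"
  shows "cro (Suc n) \<sigma> = cro n \<pi> + (v - Suc m)" "fwex (Suc n) \<sigma> = fwex n \<pi> + 2"
    "\<sigma> \<in> bounded_tail (Suc n) (Suc m) m"
proof -
  have sp: "\<pi> \<in> signed_perms n" and tail: "\<And>a. a > m \<Longrightarrow> \<pi> a \<le> int m"
    using \<pi> by (auto simp: bounded_tail_def)
  have i1: "1 \<le> Suc m" and i2: "Suc m \<le> Suc n" using v by auto
  have sps: "\<sigma> \<in> signed_perms (Suc n)"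
    unfolding \<sigma>_def using v by (intro insert_letter_in_signed_perms[OF sp]) auto
  have tails: "\<sigma> a \<le> int m" if "a > Suc m" for a
  proof (cases a "Suc m" rule: skip_cases)
    case (2 j)
    with that have "j > m" by (auto simp: skip_def split: if_splits)
    with 2 v tail[of j] show ?thesis by (auto simp: \<sigma>_def insert_letter_skip lift_def)
  qed (use that in simp)
  then show "\<sigma> \<in> bounded_tail (Suc n) (Suc m) m" using sps by (simp add: bounded_tail_def)
  have tail': "a \<le> m \<or> \<pi> a \<le> int m" for a using tail[of a] by linarith
  have wx: "int (skip (Suc m) j) \<le> lift (int v) (\<pi> j) \<longleftrightarrow> int j \<le> \<pi> j" for j
    using tail'[of j] v by (auto simp: skip_def lift_def)
  have cr: "is_crossing \<sigma> (skip (Suc m) a) (skip (Suc m) b) \<longleftrightarrow> is_crossing \<pi> a b" for a b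
    using tail'[of a] tail'[of b] v unfolding \<sigma>_def is_crossing_def insert_letter_skip
    by (auto simp: skip_def lift_def)
  have at: "\<sigma> (Suc m) = int v" by (simp add: \<sigma>_def)
  have "{b \<in> {1..Suc n}. is_crossing \<sigma> (Suc m) b} = {}"
  proof -
    have "\<not> is_crossing \<sigma> (Suc m) b" if "b \<in> {1..Suc n}" for b
      using v that tails[of b] unfolding is_crossing_def by (auto simp: at)
    then show ?thesis by auto
  qed
  moreover have "card {a \<in> {1..Suc n}. is_crossing \<sigma> a (Suc m)} = v - Suc m"
  proof -
    \<comment> \<open>The first kind of crossing accounts for positive letters, which must then
      stand before position m+1, and the second kind for negative ones.\<close>
    have "is_crossing \<sigma> a (Suc m) \<longleftrightarrow> int (Suc m) \<le> \<bar>\<sigma> a\<bar> \<and> \<bar>\<sigma> a\<bar> \<le> int v - 1" for a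
      using v tails[of a] unfolding is_crossing_def by (cases "a = Suc m") (auto simp: at)
    then have "{a \<in> {1..Suc n}. is_crossing \<sigma> a (Suc m)} =
        {a \<in> {1..Suc n}. int (Suc m) \<le> \<bar>\<sigma> a\<bar> \<and> \<bar>\<sigma> a\<bar> \<le> int v - 1}" by auto
    also have "card \<dots> = nat (int v - 1 + 1 - int (Suc m))"
      by (rule card_values[OF sps]) (use v in auto)
    finally show ?thesis by simp
  qed
  ultimately show "cro (Suc n) \<sigma> = cro n \<pi> + (v - Suc m)"
    using cro_insert_letter[OF i1 i2, of "int v" \<pi>] cr unfolding \<sigma>_def by simp
  show "fwex (Suc n) \<sigma> = fwex n \<pi> + 2"
    unfolding fwex_def \<sigma>_def using v wx neg_insert_letter[OF i1 i2]
    by (subst wex_insert_letter[OF i1 i2]) auto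
qed

text \<open>With both bounds 0 all letters are negative. The last letter -w crosses precisely the
  letters below it, by the third kind, and there are n+1-w of these.\<close>

lemma negative_insertion:
  assumes \<pi>: "\<pi> \<in> bounded_tail n 0 0" and w: "1 \<le> w" "w \<le> Suc n"
  defines "\<sigma> \<equiv> insert_letter (Suc n) (- int w) \<pi>"
  shows "cro (Suc n) \<sigma> = cro n \<pi> + (Suc n - w)" "fwex (Suc n) \<sigma> = fwex n \<pi> + 1"
    "\<sigma> \<in> bounded_tail (Suc n) 0 0"
proof -
  have sp: "\<pi> \<in> signed_perms n" and tail: "\<And>a. a > 0 \<Longrightarrow> \<pi> a \<le> 0"
    using \<pi> by (auto simp: bounded_tail_def)
  have i1: "1 \<le> Suc n" and i2: "Suc n \<le> Suc n" by auto
  have sps: "\<sigma> \<in> signed_perms (Suc n)"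
    unfolding \<sigma>_def using w by (intro insert_letter_in_signed_perms[OF sp]) auto
  have tails: "\<sigma> a \<le> 0" if "a > 0" for a
  proof (cases a "Suc n" rule: skip_cases)
    case (2 j)
    with that have "j > 0" by (auto simp: skip_def split: if_splits)
    with 2 w tail[of j] show ?thesis by (auto simp: \<sigma>_def insert_letter_skip lift_def)
  qed (use w in \<open>simp add: \<sigma>_def\<close>)
  then show "\<sigma> \<in> bounded_tail (Suc n) 0 0" using sps by (simp add: bounded_tail_def)
  have tail': "a = 0 \<or> \<pi> a \<le> 0" for a using tail[of a] by linarith
  have wx: "int (skip (Suc n) j) \<le> lift (- int w) (\<pi> j) \<longleftrightarrow> int j \<le> \<pi> j" if "1 \<le> j" "j \<le> n" for j
    using that tail'[of j] w by (auto simp: skip_def lift_def)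
  have cr: "is_crossing \<sigma> (skip (Suc n) a) (skip (Suc n) b) \<longleftrightarrow> is_crossing \<pi> a b"
    if "1 \<le> a" "a \<le> n" "1 \<le> b" "b \<le> n" for a b
    using that tail'[of a] tail'[of b] w unfolding \<sigma>_def is_crossing_def insert_letter_skip
    by (auto simp: skip_def lift_def)
  have at: "\<sigma> (Suc n) = - int w" by (simp add: \<sigma>_def)
  have "card {b \<in> {1..Suc n}. is_crossing \<sigma> (Suc n) b} = Suc n - w"
  proof -
    have "is_crossing \<sigma> (Suc n) b \<longleftrightarrow> int (Suc w) \<le> \<bar>\<sigma> b\<bar> \<and> \<bar>\<sigma> b\<bar> \<le> int (Suc n)"
      if "b \<in> {1..Suc n}" for b
      using w that tails[of b] signed_perms_bounds[OF sps, of b] unfolding is_crossing_def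
      by (cases "b = Suc n") (auto simp: at)
    then have "{b \<in> {1..Suc n}. is_crossing \<sigma> (Suc n) b} =
        {b \<in> {1..Suc n}. int (Suc w) \<le> \<bar>\<sigma> b\<bar> \<and> \<bar>\<sigma> b\<bar> \<le> int (Suc n)}" by auto
    also have "card \<dots> = nat (int (Suc n) + 1 - int (Suc w))"
      by (rule card_values[OF sps]) (use w in auto)
    finally show ?thesis by simp
  qed
  moreover have "{a \<in> {1..Suc n}. is_crossing \<sigma> a (Suc n)} = {}"
  proof -
    have "\<not> is_crossing \<sigma> a (Suc n)" if "a \<in> {1..Suc n}" for a
      using w that tails[of a] unfolding is_crossing_def by (auto simp: at)
    then show ?thesis by auto
  qed
  ultimately show "cro (Suc n) \<sigma> = cro n \<pi> + (Suc n - w)"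
    using cro_insert_letter[OF i1 i2, of "- int w" \<pi>] cr unfolding \<sigma>_def by simp
  show "fwex (Suc n) \<sigma> = fwex n \<pi> + 1"
    unfolding fwex_def \<sigma>_def using w wx neg_insert_letter[OF i1 i2]
    by (subst wex_insert_letter[OF i1 i2]) auto
qed

section \<open>Decomposition of signed permutations\<close>

lemma finite_bounded_tail: "finite (bounded_tail n p r)"
  by (rule finite_subset[OF _ finite_signed_perms[of n]]) (auto simp: bounded_tail_def)

lemma bounded_tail_full: "bounded_tail n n n = signed_perms n"
  using signed_perms_upper by (auto simp: bounded_tail_def)

lemma bounded_tail_signed_perms: "\<pi> \<in> bounded_tail n p r \<Longrightarrow> \<pi> \<in> signed_perms n"
  by (simp add: bounded_tail_def)

lemma delete_letter_bounded_tail: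
  assumes "\<pi> \<in> signed_perms (Suc n)" "1 \<le> i" "i \<le> Suc n" "\<pi> i = v"
    and "\<And>a. a > p \<Longrightarrow> skip i a \<noteq> i \<Longrightarrow> lower v (\<pi> (skip i a)) \<le> int r"
  shows "\<pi> \<in> insert_letter i v ` bounded_tail n p r"
proof (rule image_eqI)
  show "\<pi> = insert_letter i v (delete_letter i v \<pi>)"
    using delete_letter_in_signed_perms(2)[OF assms(1-4)] by simp
  show "delete_letter i v \<pi> \<in> bounded_tail n p r"
    unfolding bounded_tail_def using delete_letter_in_signed_perms(1)[OF assms(1-4)] assms(5)
    by (auto simp: delete_letter_def skip_neq)
qed

text \<open>Raising the bound from m to m+1 admits just one more value in the tail, and m+1 occurs
  at most once; where it does occur it can be deleted.\<close>

lemma bounded_tail_lower: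
  "bounded_tail (Suc n) (Suc m) (Suc m) = bounded_tail (Suc n) (Suc m) m \<union>
     (\<Union>i\<in>{Suc m<..Suc n}. insert_letter i (int (Suc m)) ` bounded_tail n (Suc m) m)" (is "?L = ?A \<union> ?B")
proof (intro equalityI subsetI)
  fix \<pi> assume p: "\<pi> \<in> ?L"
  then have sp: "\<pi> \<in> signed_perms (Suc n)" and tail: "\<And>a. a > Suc m \<Longrightarrow> \<pi> a \<le> int (Suc m)"
    by (auto simp: bounded_tail_def)
  show "\<pi> \<in> ?A \<union> ?B"
  proof (cases "\<pi> \<in> ?A")
    case False
    then obtain i where i: "i > Suc m" "\<not> \<pi> i \<le> int m" using sp by (auto simp: bounded_tail_def)
    then have eq: "\<pi> i = int (Suc m)" using tail[OF i(1)] by linarith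
    have i2: "i \<le> Suc n" using signed_perms_outside[OF sp, of i] eq by (cases "i \<le> Suc n") auto
    have "\<pi> \<in> insert_letter i (int (Suc m)) ` bounded_tail n (Suc m) m"
    proof (rule delete_letter_bounded_tail[OF sp _ i2 eq])
      fix a assume a: "a > Suc m" "skip i a \<noteq> i"
      then have gt: "skip i a > Suc m" by (auto simp: skip_def)
      have "\<pi> (skip i a) \<noteq> int (Suc m)"
      proof
        assume h: "\<pi> (skip i a) = int (Suc m)"
        then have "skip i a \<le> Suc n" using signed_perms_outside[OF sp, of "skip i a"]
          by (cases "skip i a \<le> Suc n") auto
        then show False using signed_perms_inj[OF sp, of "skip i a" i] gt i i2 eq h a by auto
      qed
      then show "lower (int (Suc m)) (\<pi> (skip i a)) \<le> int m"
        using tail[OF gt] by (auto simp: lower_def)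
    qed (use i in simp)
    then show ?thesis using i i2 by auto
  qed simp
next
  fix \<pi> assume "\<pi> \<in> ?A \<union> ?B"
  then show "\<pi> \<in> ?L" using lower_insertion(3) by (force simp: bounded_tail_def)
qed

text \<open>Only the letter at position m+1 is released from the bound. If it exceeds m, deleting it
  leaves a word bounded by m after position m.\<close>

lemma bounded_tail_upper:
  "bounded_tail (Suc n) (Suc m) m = bounded_tail (Suc n) m m \<union>
     (\<Union>v\<in>{m<..Suc n}. insert_letter (Suc m) (int v) ` bounded_tail n m m)" (is "?L = ?A \<union> ?B")
proof (intro equalityI subsetI)
  fix \<pi> assume p: "\<pi> \<in> ?L"
  then have sp: "\<pi> \<in> signed_perms (Suc n)" and tail: "\<And>a. a > Suc m \<Longrightarrow> \<pi> a \<le> int m"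
    by (auto simp: bounded_tail_def)
  show "\<pi> \<in> ?A \<union> ?B"
  proof (cases "\<pi> (Suc m) \<le> int m")
    case True
    have "\<pi> a \<le> int m" if "a > m" for a using that True tail[of a] by (cases "a = Suc m") auto
    then show ?thesis using sp by (auto simp: bounded_tail_def)
  next
    case False
    have i2: "Suc m \<le> Suc n" using signed_perms_outside[OF sp, of "Suc m"] False by (cases "Suc m \<le> Suc n") auto
    define v where "v = nat (\<pi> (Suc m))"
    have v: "\<pi> (Suc m) = int v" "m < v" "v \<le> Suc n"
      using False signed_perms_upper[OF sp, of "Suc m"] by (auto simp: v_def)
    have "\<pi> \<in> insert_letter (Suc m) (int v) ` bounded_tail n m m"
    proof (rule delete_letter_bounded_tail[OF sp _ i2 v(1)])
      fix a assume a: "a > m" "skip (Suc m) a \<noteq> Suc m"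
      then have "skip (Suc m) a > Suc m" by (auto simp: skip_def)
      then show "lower (int v) (\<pi> (skip (Suc m) a)) \<le> int m"
        using tail v(2) by (force simp: lower_def)
    qed simp
    then show ?thesis using v by auto
  qed
next
  fix \<pi> assume "\<pi> \<in> ?A \<union> ?B"
  then show "\<pi> \<in> ?L" using upper_insertion(3) by (force simp: bounded_tail_def)
qed

lemma bounded_tail_negative:
  "bounded_tail (Suc n) 0 0 =
     (\<Union>w\<in>{1..Suc n}. insert_letter (Suc n) (- int w) ` bounded_tail n 0 0)" (is "?L = ?B")
proof (intro equalityI subsetI)
  fix \<pi> assume p: "\<pi> \<in> ?L"
  then have sp: "\<pi> \<in> signed_perms (Suc n)" and tail: "\<And>a. a > 0 \<Longrightarrow> \<pi> a \<le> 0"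
    by (auto simp: bounded_tail_def)
  define w where "w = nat (- \<pi> (Suc n))"
  have w: "\<pi> (Suc n) = - int w" "1 \<le> w" "w \<le> Suc n"
    using tail[of "Suc n"] signed_perms_bounds[OF sp, of "Suc n"] by (auto simp: w_def)
  have "\<pi> \<in> insert_letter (Suc n) (- int w) ` bounded_tail n 0 0"
  proof (rule delete_letter_bounded_tail[OF sp _ _ w(1)])
    fix a assume a: "a > 0" "skip (Suc n) a \<noteq> Suc n"
    then have "skip (Suc n) a > 0" by (auto simp: skip_def)
    then show "lower (- int w) (\<pi> (skip (Suc n) a)) \<le> int 0"
      using tail[of "skip (Suc n) a"] by (auto simp: lower_def)
  qed auto
  then show "\<pi> \<in> ?B" using w by auto
next
  fix \<pi> assume "\<pi> \<in> ?B"
  then show "\<pi> \<in> ?L" using negative_insertion(3) by force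
qed

section \<open>Weighted sums over the decompositions\<close>

lemma sum_Un_images:
  fixes w :: "'b \<Rightarrow> 'a::comm_monoid_add"
  assumes "finite A" "finite S" "finite K"
    and "\<And>k s. k \<in> K \<Longrightarrow> s \<in> S \<Longrightarrow> f k s \<notin> A"
    and "\<And>k k' s s'. k \<in> K \<Longrightarrow> s \<in> S \<Longrightarrow> k' \<in> K \<Longrightarrow> s' \<in> S \<Longrightarrow> f k s = f k' s' \<Longrightarrow> k = k' \<and> s = s'"
  shows "sum w (A \<union> (\<Union>k\<in>K. f k ` S)) = sum w A + (\<Sum>k\<in>K. \<Sum>s\<in>S. w (f k s))"
proof -
  have "sum w (A \<union> (\<Union>k\<in>K. f k ` S)) = sum w A + sum w (\<Union>k\<in>K. f k ` S)"
    by (rule sum.union_disjoint) (use assms in auto)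
  also have "sum w (\<Union>k\<in>K. f k ` S) = sum w ((\<lambda>(k, s). f k s) ` (K \<times> S))"
    by (rule arg_cong[where f = "sum w"]) auto
  also have "\<dots> = (\<Sum>(k, s)\<in>K \<times> S. w (f k s))"
    by (subst sum.reindex) (use assms(5) in \<open>force simp: inj_on_def intro!: sum.cong\<close>)+
  finally show ?thesis by (simp add: sum.cartesian_product)
qed

text \<open>The weight contributed by the inserted letter depends on that letter alone, so the
  double sum separates into a product.\<close>

lemma sum_insertions:
  fixes w w' :: "'b \<Rightarrow> 'a::comm_ring_1"
  assumes "finite A" "finite S" "finite K"
    and "\<And>k s. k \<in> K \<Longrightarrow> s \<in> S \<Longrightarrow> f k s \<notin> A"
    and "\<And>k k' s s'. k \<in> K \<Longrightarrow> s \<in> S \<Longrightarrow> k' \<in> K \<Longrightarrow> s' \<in> S \<Longrightarrow> f k s = f k' s' \<Longrightarrow> k = k' \<and> s = s'"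
    and w: "\<And>k s. k \<in> K \<Longrightarrow> s \<in> S \<Longrightarrow> w (f k s) = c k * w' s"
  shows "sum w (A \<union> (\<Union>k\<in>K. f k ` S)) = sum w A + sum c K * sum w' S"
proof -
  have "sum w (A \<union> (\<Union>k\<in>K. f k ` S)) = sum w A + (\<Sum>k\<in>K. \<Sum>s\<in>S. w (f k s))"
    by (rule sum_Un_images) (use assms(1-5) in auto)
  then show ?thesis by (simp add: w sum_product)
qed

text \<open>The ring is arbitrary so that later y can be a polynomial variable and q a constant
  polynomial over any coefficient ring.\<close>

definition weight :: "'a::comm_ring_1 \<Rightarrow> 'a \<Rightarrow> nat \<Rightarrow> (nat \<Rightarrow> int) \<Rightarrow> 'a" where
  "weight y q n \<pi> = y ^ fwex n \<pi> * q ^ cro n \<pi>"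

lemma weight_shift:
  assumes "fwex n' \<sigma> = fwex n \<pi> + f" "cro n' \<sigma> = cro n \<pi> + c"
  shows "weight y q n' \<sigma> = y ^ f * q ^ c * weight y q n \<pi>"
  by (simp add: weight_def assms power_add mult_ac)

definition tail_sum :: "'a::comm_ring_1 \<Rightarrow> 'a \<Rightarrow> nat \<Rightarrow> nat \<Rightarrow> nat \<Rightarrow> 'a" where
  "tail_sum y q n p r = sum (weight y q n) (bounded_tail n p r)"

definition qnum :: "'a::comm_ring_1 \<Rightarrow> nat \<Rightarrow> 'a" where
  "qnum q n = (\<Sum>i<n. q ^ i)"

definition qfact :: "'a::comm_ring_1 \<Rightarrow> nat \<Rightarrow> 'a" where
  "qfact q n = (\<Prod>i<n. qnum q (Suc i))"

lemma sum_powers_shift: "(\<Sum>i\<in>{m<..n}. q ^ (i - Suc m)) = qnum (q::'a::comm_ring_1) (n - m)"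
  unfolding qnum_def
  by (rule sum.reindex_bij_witness[where i = "\<lambda>i. i + Suc m" and j = "\<lambda>i. i - Suc m"]) auto

lemma tail_sum_lower:
  "tail_sum y q (Suc n) (Suc m) (Suc m) =
     tail_sum y q (Suc n) (Suc m) m + qnum q (n - m) * tail_sum y q n (Suc m) m"
proof -
  have neq: "insert_letter i (int (Suc m)) \<pi> \<notin> bounded_tail (Suc n) (Suc m) m"
    if "i > Suc m" for i \<pi>
    using that insert_letter_at[of i "int (Suc m)" \<pi>] by (fastforce simp: bounded_tail_def)
  have inj: "i = j \<and> \<pi> = \<rho>"
    if "i \<in> {Suc m<..Suc n}" "\<pi> \<in> bounded_tail n (Suc m) m" "j \<in> {Suc m<..Suc n}"
      "insert_letter i (int (Suc m)) \<pi> = insert_letter j (int (Suc m)) \<rho>" for i j \<pi> \<rho>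
  proof -
    let ?\<sigma> = "insert_letter i (int (Suc m)) \<pi>"
    have "?\<sigma> i = ?\<sigma> j" unfolding that(4) using that(4) insert_letter_at by metis
    moreover have "?\<sigma> \<in> signed_perms (Suc n)"
      using lower_insertion(3)[OF that(2), of i] that(1) bounded_tail_signed_perms by auto
    ultimately have "i = j" using signed_perms_inj[of ?\<sigma> "Suc n" i j] that by auto
    then show ?thesis using that(4) injD[OF insert_letter_inj, of "int (Suc m)" i \<pi> \<rho>] by auto
  qed
  have "tail_sum y q (Suc n) (Suc m) (Suc m) = tail_sum y q (Suc n) (Suc m) m +
      (\<Sum>i\<in>{Suc m<..Suc n}. q ^ (i - Suc (Suc m))) * tail_sum y q n (Suc m) m"
    unfolding tail_sum_def bounded_tail_lower
  proof (rule sum_insertions)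
    fix i \<pi> assume "i \<in> {Suc m<..Suc n}" "\<pi> \<in> bounded_tail n (Suc m) m"
    then show "weight y q (Suc n) (insert_letter i (int (Suc m)) \<pi>) = q ^ (i - Suc (Suc m)) * weight y q n \<pi>"
      using lower_insertion(1,2)[of \<pi> n m i]
      by (subst weight_shift[of _ _ n \<pi> 0]) auto
  next
    fix i j \<pi> \<rho>
    assume "i \<in> {Suc m<..Suc n}" "\<pi> \<in> bounded_tail n (Suc m) m" "j \<in> {Suc m<..Suc n}"
      "insert_letter i (int (Suc m)) \<pi> = insert_letter j (int (Suc m)) \<rho>"
    then show "i = j \<and> \<pi> = \<rho>" by (rule inj)
  qed (use neq finite_bounded_tail in auto)
  then show ?thesis by (simp only: sum_powers_shift diff_Suc_Suc)
qed

lemma tail_sum_upper: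
  "tail_sum y q (Suc n) (Suc m) m =
     tail_sum y q (Suc n) m m + y\<^sup>2 * qnum q (Suc n - m) * tail_sum y q n m m"
proof -
  have neq: "insert_letter (Suc m) (int v) \<pi> \<notin> bounded_tail (Suc n) m m" if "v > m" for v \<pi>
    using that insert_letter_at[of "Suc m" "int v" \<pi>] by (fastforce simp: bounded_tail_def)
  have inj: "u = v \<and> \<pi> = \<rho>"
    if "v > m" "insert_letter (Suc m) (int u) \<pi> = insert_letter (Suc m) (int v) \<rho>" for u v \<pi> \<rho>
  proof -
    have "int u = int v" using that(2) insert_letter_at by metis
    then show ?thesis using that injD[OF insert_letter_inj, of "int v" "Suc m" \<pi> \<rho>] by auto
  qed
  have "tail_sum y q (Suc n) (Suc m) m = tail_sum y q (Suc n) m m +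
      (\<Sum>v\<in>{m<..Suc n}. y\<^sup>2 * q ^ (v - Suc m)) * tail_sum y q n m m"
    unfolding tail_sum_def bounded_tail_upper
  proof (rule sum_insertions)
    fix v \<pi> assume "v \<in> {m<..Suc n}" "\<pi> \<in> bounded_tail n m m"
    then show "weight y q (Suc n) (insert_letter (Suc m) (int v) \<pi>) = y\<^sup>2 * q ^ (v - Suc m) * weight y q n \<pi>"
      using upper_insertion(1,2)[of \<pi> n m v]
      by (subst weight_shift[of _ _ n \<pi> 2]) auto
  next
    fix u v \<pi> \<rho>
    assume "v \<in> {m<..Suc n}" "insert_letter (Suc m) (int u) \<pi> = insert_letter (Suc m) (int v) \<rho>"
    then show "u = v \<and> \<pi> = \<rho>" by (intro inj) auto
  qed (use neq finite_bounded_tail in auto)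
  then show ?thesis by (simp only: sum_powers_shift flip: sum_distrib_left)
qed

lemma tail_sum_negative: "tail_sum y q n 0 0 = y ^ n * qfact q n"
proof (induction n)
  case 0
  have "bounded_tail 0 0 0 = {\<lambda>_. 0}" by (auto simp: bounded_tail_def signed_perms_0)
  then show ?case by (simp add: tail_sum_def weight_def qfact_def fwex_def wex_def neg_def cro_def)
next
  case (Suc n)
  have inj: "u = v \<and> \<pi> = \<rho>"
    if "v > 0" "insert_letter (Suc n) (- int u) \<pi> = insert_letter (Suc n) (- int v) \<rho>" for u v \<pi> \<rho>
  proof -
    have "- int u = - int v" using that(2) insert_letter_at by metis
    then show ?thesis using that injD[OF insert_letter_inj, of "- int v" "Suc n" \<pi> \<rho>] by auto
  qed
  have "sum (weight y q (Suc n)) ({} \<union> (\<Union>w\<in>{1..Suc n}. insert_letter (Suc n) (- int w) ` bounded_tail n 0 0)) =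
      sum (weight y q (Suc n)) {} + (\<Sum>w\<in>{1..Suc n}. y * q ^ (Suc n - w)) * tail_sum y q n 0 0"
    unfolding tail_sum_def
  proof (rule sum_insertions)
    fix w \<pi> assume "w \<in> {1..Suc n}" "\<pi> \<in> bounded_tail n 0 0"
    then show "weight y q (Suc n) (insert_letter (Suc n) (- int w) \<pi>) = y * q ^ (Suc n - w) * weight y q n \<pi>"
      using negative_insertion(1,2)[of \<pi> n w]
      by (subst weight_shift[of _ _ n \<pi> 1]) auto
  next
    fix u v \<pi> \<rho>
    assume "v \<in> {1..Suc n}" "insert_letter (Suc n) (- int u) \<pi> = insert_letter (Suc n) (- int v) \<rho>"
    then show "u = v \<and> \<pi> = \<rho>" by (intro inj) auto
  qed (use finite_bounded_tail in auto)
  then have "tail_sum y q (Suc n) 0 0 = (\<Sum>w\<in>{1..Suc n}. y * q ^ (Suc n - w)) * tail_sum y q n 0 0"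
    unfolding tail_sum_def bounded_tail_negative by simp
  also have "(\<Sum>w\<in>{1..Suc n}. y * q ^ (Suc n - w)) = y * qnum q (Suc n)"
    unfolding qnum_def sum_distrib_left
    by (rule sum.reindex_bij_witness[where i = "\<lambda>i. Suc n - i" and j = "\<lambda>i. Suc n - i"]) auto
  finally show ?case using Suc by (simp add: qfact_def mult_ac)
qed

text \<open>At \<open>h = 0\<close> the truncated \<open>h - 1\<close> is harmless, because its factor \<open>qnum q 0\<close> is \<open>0\<close>.\<close>
fun path_sum :: "'a::comm_ring_1 \<Rightarrow> 'a \<Rightarrow> nat \<Rightarrow> nat \<Rightarrow> 'a" where
  "path_sum y q 0 h = 1"
| "path_sum y q (Suc n) h = y * qnum q (h + 2) * path_sum y q n (h + 1) +
     (1 + y\<^sup>2) * qnum q (h + 1) * path_sum y q n h + y * qnum q h * path_sum y q n (h - 1)"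

lemma qnum_0 [simp]: "qnum q 0 = 0"
  by (simp add: qnum_def)

lemma qfact_Suc: "qfact q (Suc n) = qfact q n * qnum q (Suc n)"
  by (simp add: qfact_def)

text \<open>Here h is the number of positions after m+1. Splitting off (1+y) y^(h+1) and the
  q-factorial of h+1 turns the alternating removals into the three-term recurrence of
  \<open>path_sum\<close>.\<close>

lemma tail_sum_path_sum:
  "tail_sum y q (Suc m + h) (Suc m) m = (1 + y) * y ^ Suc h * qfact q (Suc h) * path_sum y q m h"
proof (induction m arbitrary: h)
  case 0
  \<comment> \<open>The factor 1+y comes from the first letter being negative or positive while all
    others are negative.\<close>
  show ?case using tail_sum_upper[of y q h 0] 
    by (simp add: tail_sum_negative qfact_Suc power2_eq_square algebra_simps)
next
  case (Suc m)
  \<comment> \<open>Eliminates the sums with equal bounds. \<open>tail_sum_upper\<close> then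
    combines the cases h and h+1 of this formula.\<close>
  have P: "tail_sum y q (Suc m + k) (Suc m) (Suc m) =
      (1 + y) * y ^ Suc k * qfact q (Suc k) * path_sum y q m k +
      qnum q k * ((1 + y) * y ^ k * qfact q k * path_sum y q m (k - 1))" for k
  proof (cases k)
    case 0
    then show ?thesis using tail_sum_lower[of y q m m] Suc.IH[of 0] by simp
  next
    case (Suc k')
    then show ?thesis using tail_sum_lower[of y q "m + k" m] Suc.IH[of k] Suc.IH[of k'] by simp
  qed
  show ?case using tail_sum_upper[of y q "Suc m + h" "Suc m"] P[of h] P[of "Suc h"]
    by (simp add: qfact_Suc power2_eq_square algebra_simps)
qed

lemma sum_weight_signed_perms:
  "sum (weight y q (Suc m)) (signed_perms (Suc m)) = y * (1 + y) * path_sum y q m 0"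
proof -
  \<comment> \<open>For words of length m+1 no position lies beyond m+1, so the tail condition is
    empty; in \<open>tail_sum_lower\<close> this shows as the factor
    \<open>qnum q 0\<close>.\<close>
  have "sum (weight y q (Suc m)) (signed_perms (Suc m)) = tail_sum y q (Suc m) (Suc m) m"
    using tail_sum_lower[of y q m m] by (simp add: tail_sum_def bounded_tail_full)
  also have "\<dots> = y * (1 + y) * path_sum y q m 0"
    using tail_sum_path_sum[of y q m 0] by (simp add: qfact_def qnum_def mult_ac)
  finally show ?thesis .
qed

section \<open>Type B descents\<close>

text \<open>The letter enters the gap after position g. Being extreme, it destroys a descent at that
  gap and creates one, before itself if negative and after itself if positive; only a positive
  letter at the end creates none. The additive form avoids subtraction of naturals.\<close>

lemma des_B_insert_letter:
  assumes \<pi>: "\<pi> \<in> signed_perms n" and g: "g \<le> n" and v: "\<bar>v\<bar> = int (Suc n)"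
  shows "des_B (Suc n) (insert_letter (Suc g) v \<pi>) + (if g < n \<and> \<pi> g > \<pi> (Suc g) then 1 else 0) =
    des_B n \<pi> + (if v < 0 \<or> g < n then 1 else 0)"
proof -
  define \<sigma> where "\<sigma> = insert_letter (Suc g) v \<pi>"
  define D where "D = {i \<in> {0..<n}. \<pi> i > \<pi> (Suc i)}"
  have fin: "finite D" by (simp add: D_def)
  have bd: "\<bar>\<pi> a\<bar> \<le> int n" for a
    using signed_perms_bounds[OF \<pi>, of a] signed_perms_outside[OF \<pi>, of a] by (cases "1 \<le> a \<and> a \<le> n") auto
  have lift: "lift v (\<pi> a) = \<pi> a" for a
  proof -
    have "\<not> \<bar>v\<bar> \<le> \<pi> a" "\<not> \<pi> a \<le> - \<bar>v\<bar>" using v bd[of a] by linarith+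
    then show ?thesis by (simp add: lift_def)
  qed
  have at: "\<sigma> a = (if a \<le> g then \<pi> a else if a = Suc g then v else \<pi> (a - 1))" for a
    by (auto simp: \<sigma>_def insert_letter_def lift)
  have gt: "\<pi> a > v \<longleftrightarrow> v < 0" "v > \<pi> a \<longleftrightarrow> v > 0" for a
    using bd[of a] v by auto
  \<comment> \<open>Descents before the gap stay, those after it move up by one, and the last set is
    the descent made by the new letter.\<close>
  have "{i \<in> {0..<Suc n}. \<sigma> i > \<sigma> (Suc i)} =
      {i \<in> D. i < g} \<union> (Suc ` {i \<in> D. g < i} \<union> (if v < 0 then {g} else if g < n then {Suc g} else {}))"
    (is "?L = ?R")
  proof (intro equalityI subsetI)
    fix i assume i: "i \<in> ?L"
    consider "i < g" | "i = g" | "i = Suc g" | k where "i = Suc k" "g < k"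
      by (metis linorder_neqE_nat not_less_eq Suc_lessE)
    then show "i \<in> ?R"
    proof cases
      case 4
      then show ?thesis using i by (auto simp: at D_def)
    qed (use i v g gt in \<open>auto simp: at D_def\<close>)
  next
    fix i assume "i \<in> ?R"
    then consider "i \<in> D" "i < g" | k where "i = Suc k" "k \<in> D" "g < k" | "v < 0" "i = g"
      | "\<not> v < 0" "g < n" "i = Suc g" by (auto split: if_splits)
    then show "i \<in> ?L" using v g gt by cases (auto simp: at D_def)
  qed
  moreover have "card ?R = card {i \<in> D. i < g} + (card {i \<in> D. g < i} + (if v < 0 \<or> g < n then 1 else 0))"
  proof -
    let ?C = "if v < 0 then {g} else if g < n then {Suc g} else {}"
    have "card (Suc ` {i \<in> D. g < i} \<union> ?C) = card (Suc ` {i \<in> D. g < i}) + card ?C"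
      by (rule card_Un_disjoint) (auto simp: fin)
    moreover have "card ?R = card {i \<in> D. i < g} + card (Suc ` {i \<in> D. g < i} \<union> ?C)"
      by (rule card_Un_disjoint) (auto simp: fin)
    moreover have "card ?C = (if v < 0 \<or> g < n then 1 else 0)" by auto
    ultimately show ?thesis by (simp add: card_image)
  qed
  moreover have "card D = card {i \<in> D. i < g} + (card {i \<in> D. g < i} + (if g \<in> D then 1 else 0))"
  proof -
    let ?C = "if g \<in> D then {g} else {}"
    have "D = {i \<in> D. i < g} \<union> ({i \<in> D. g < i} \<union> ?C)"
      by (auto simp: not_less order_le_less)
    also have "card \<dots> = card {i \<in> D. i < g} + card ({i \<in> D. g < i} \<union> ?C)"
      by (rule card_Un_disjoint) (auto simp: fin)
    also have "card ({i \<in> D. g < i} \<union> ?C) = card {i \<in> D. g < i} + card ?C"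
      by (rule card_Un_disjoint) (auto simp: fin)
    finally show ?thesis by simp
  qed
  moreover have "g \<in> D \<longleftrightarrow> g < n \<and> \<pi> g > \<pi> (Suc g)" by (auto simp: D_def)
  ultimately show ?thesis unfolding des_B_def by (simp add: D_def \<sigma>_def)
qed

lemma signed_perms_Suc_insert_top:
  "signed_perms (Suc n) =
    (\<Union>(g, v)\<in>{..n} \<times> {int (Suc n), - int (Suc n)}. insert_letter (Suc g) v ` signed_perms n)"
proof (intro equalityI subsetI)
  fix \<pi> assume p: "\<pi> \<in> signed_perms (Suc n)"
  obtain i where i: "1 \<le> i" "i \<le> Suc n" "\<bar>\<pi> i\<bar> = int (Suc n)"
    using signed_perms_obtain[OF p, of "int (Suc n)"] by auto
  have "\<pi> \<in> insert_letter i (\<pi> i) ` signed_perms n"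
    using p i by (subst insert_letter_image) auto
  moreover have "(i - 1, \<pi> i) \<in> {..n} \<times> {int (Suc n), - int (Suc n)}" using i by auto
  ultimately show "\<pi> \<in> (\<Union>(g, v)\<in>{..n} \<times> {int (Suc n), - int (Suc n)}. insert_letter (Suc g) v ` signed_perms n)"
    using i by (intro UN_I[of "(i - 1, \<pi> i)"]) auto
next
  fix \<pi> assume "\<pi> \<in> (\<Union>(g, v)\<in>{..n} \<times> {int (Suc n), - int (Suc n)}. insert_letter (Suc g) v ` signed_perms n)"
  then obtain g v \<rho> where "g \<le> n" "v = int (Suc n) \<or> v = - int (Suc n)" "\<rho> \<in> signed_perms n"
    "\<pi> = insert_letter (Suc g) v \<rho>" by auto
  then show "\<pi> \<in> signed_perms (Suc n)" using insert_letter_in_signed_perms[of \<rho> n "Suc g" v] by auto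
qed

lemma sum_signed_perms_Suc:
  fixes w :: "_ \<Rightarrow> 'a::comm_monoid_add"
  shows "sum w (signed_perms (Suc n)) =
    (\<Sum>\<pi>\<in>signed_perms n. \<Sum>g\<le>n. w (insert_letter (Suc g) (int (Suc n)) \<pi>) + w (insert_letter (Suc g) (- int (Suc n)) \<pi>))"
proof -
  let ?K = "{..n} \<times> {int (Suc n), - int (Suc n)}"
  have "sum w ({} \<union> (\<Union>k\<in>?K. (\<lambda>(g, v). insert_letter (Suc g) v) k ` signed_perms n)) =
      sum w {} + (\<Sum>k\<in>?K. \<Sum>\<pi>\<in>signed_perms n. w ((\<lambda>(g, v). insert_letter (Suc g) v) k \<pi>))"
  proof (rule sum_Un_images)
    fix k k' \<pi> \<rho>
    assume *: "k \<in> ?K" "\<pi> \<in> signed_perms n" "k' \<in> ?K" "\<rho> \<in> signed_perms n"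
      "(\<lambda>(g, v). insert_letter (Suc g) v) k \<pi> = (\<lambda>(g, v). insert_letter (Suc g) v) k' \<rho>"
    obtain g v g' v' where k: "k = (g, v)" "k' = (g', v')" by fastforce
    have v: "\<bar>v\<bar> = int (Suc n)" "\<bar>v'\<bar> = int (Suc n)" "v \<noteq> 0" "v' \<noteq> 0" "g \<le> n" "g' \<le> n" using * k by auto
    let ?\<sigma> = "insert_letter (Suc g) v \<pi>"
    have eq: "?\<sigma> = insert_letter (Suc g') v' \<rho>" using * k by simp
    have "?\<sigma> \<in> signed_perms (Suc n)" using insert_letter_in_signed_perms[OF *(2), of "Suc g" v] v by auto
    moreover have "?\<sigma> (Suc g) = v" "?\<sigma> (Suc g') = v'" by (simp, simp add: eq)
    \<comment> \<open>The absolute value n+1 occurs once, so the word determines the gap.\<close>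
    ultimately have "Suc g = Suc g'" using signed_perms_inj[of ?\<sigma> "Suc n" "Suc g" "Suc g'"] v by auto
    moreover from this have "v = v'" using eq by (metis insert_letter_at)
    ultimately show "k = k' \<and> \<pi> = \<rho>" using k eq injD[OF insert_letter_inj, of v "Suc g" \<pi> \<rho>] v by auto
  qed (use finite_signed_perms in auto)
  then have "sum w (signed_perms (Suc n)) = (\<Sum>(g, v)\<in>?K. \<Sum>\<pi>\<in>signed_perms n. w (insert_letter (Suc g) v \<pi>))"
    unfolding signed_perms_Suc_insert_top by (simp add: case_prod_unfold)
  also have "\<dots> = (\<Sum>g\<le>n. \<Sum>\<pi>\<in>signed_perms n. w (insert_letter (Suc g) (int (Suc n)) \<pi>) + w (insert_letter (Suc g) (- int (Suc n)) \<pi>))"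
    by (simp add: sum.distrib flip: sum.cartesian_product)
  also have "\<dots> = (\<Sum>\<pi>\<in>signed_perms n. \<Sum>g\<le>n. w (insert_letter (Suc g) (int (Suc n)) \<pi>) + w (insert_letter (Suc g) (- int (Suc n)) \<pi>))"
    by (rule sum.swap)
  finally show ?thesis .
qed

lemma eulerian_B_sum: "int (eulerian_B n k) = (\<Sum>\<pi>\<in>signed_perms n. of_bool (des_B n \<pi> = k))"
  by (simp add: eulerian_B_def finite_signed_perms Int_def sum.If_cases of_bool_def)

text \<open>Take a word with d descents. Both signs keep d in the d descent gaps and raise it in the
  n-d ascent gaps; in the end gap one sign keeps it and the other raises it. So 2d+1 insertions keep
  d and 2(n-d)+1 raise it.\<close>

lemma eulerian_B_Suc:
  "int (eulerian_B (Suc n) k) = (2 * int k + 1) * int (eulerian_B n k) +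
     (if k = 0 then 0 else (2 * int n + 3 - 2 * int k) * int (eulerian_B n (k - 1)))"
proof -
  let ?N = "int (Suc n)"
  have "(\<Sum>g\<le>n. of_bool (des_B (Suc n) (insert_letter (Suc g) ?N \<pi>) = k) +
        of_bool (des_B (Suc n) (insert_letter (Suc g) (- ?N) \<pi>) = k)) =
      (2 * int k + 1) * of_bool (des_B n \<pi> = k) +
      (if k = 0 then 0 else (2 * int n + 3 - 2 * int k) * of_bool (des_B n \<pi> = k - 1))"
    (is "(\<Sum>g\<le>n. ?w g) = ?r") if p: "\<pi> \<in> signed_perms n" for \<pi>
  proof -
    let ?d = "des_B n \<pi>"
    define D where "D = {i \<in> {0..<n}. \<pi> i > \<pi> (Suc i)}"
    have D: "D \<subseteq> {..<n}" "card D = ?d" by (auto simp: D_def des_B_def)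
    have w: "?w g = (if g \<in> D then 2 * of_bool (?d = k) else if g < n then 2 * of_bool (Suc ?d = k)
        else of_bool (?d = k) + of_bool (Suc ?d = k))" if "g \<le> n" for g
      using des_B_insert_letter[OF p that, of ?N] des_B_insert_letter[OF p that, of "- ?N"] that
      by (cases "g < n"; cases "\<pi> g > \<pi> (Suc g)") (auto simp: D_def)
    have "(\<Sum>g\<le>n. ?w g) = (\<Sum>g<n. ?w g) + ?w n"
      by (simp add: lessThan_Suc_atMost[symmetric])
    also have "?w n = of_bool (?d = k) + of_bool (Suc ?d = k)" using w[of n] D by auto
    also have "(\<Sum>g<n. ?w g) = (\<Sum>g<n. if g \<in> D then 2 * of_bool (?d = k) else 2 * of_bool (Suc ?d = k))"
      by (rule sum.cong) (use w in auto)
    also have "\<dots> = int (card D) * (2 * of_bool (?d = k)) + int (card ({..<n} - D)) * (2 * of_bool (Suc ?d = k))"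
      using D(1) by (simp add: sum.If_cases Int_absorb1 Diff_eq)
    also have "int (card ({..<n} - D)) = int n - int ?d"
      using D card_mono[OF _ D(1)] by (simp add: card_Diff_subset finite_subset[OF D(1)])
    finally show ?thesis using D(2) by (auto simp: of_bool_def)
  qed
  then have "int (eulerian_B (Suc n) k) = (\<Sum>\<pi>\<in>signed_perms n. (2 * int k + 1) * of_bool (des_B n \<pi> = k) +
      (if k = 0 then 0 else (2 * int n + 3 - 2 * int k) * of_bool (des_B n \<pi> = k - 1)))"
    unfolding eulerian_B_sum sum_signed_perms_Suc by (intro sum.cong) auto
  also have "\<dots> = (2 * int k + 1) * int (eulerian_B n k) +
     (if k = 0 then 0 else (2 * int n + 3 - 2 * int k) * int (eulerian_B n (k - 1)))"
    unfolding eulerian_B_sum by (simp add: sum.distrib sum_distrib_left)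
  finally show ?thesis .
qed

lemma eulerian_B_0: "int (eulerian_B 0 k) = of_bool (k = 0)"
  unfolding eulerian_B_sum by (auto simp: signed_perms_0 des_B_def)

section \<open>Coefficients of the path sums\<close>

text \<open>Integer indices make the shifts by 1 and 2 and the reflection of indices valid without
  case distinctions.\<close>

definition icoeff :: "'a::zero poly \<Rightarrow> int \<Rightarrow> 'a" where
  "icoeff p i = (if i < 0 then 0 else coeff p (nat i))"

lemma icoeff_add: "icoeff (p + q) i = icoeff p i + icoeff (q :: 'a::comm_ring_1 poly) i"
  by (simp add: icoeff_def)

lemma icoeff_smult: "icoeff (smult a p) i = a * icoeff (p :: 'a::comm_ring_1 poly) i"
  by (simp add: icoeff_def)

lemma icoeff_pCons: "icoeff (pCons a p) i = (if i = 0 then a else icoeff p (i - 1))"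
proof (cases "i > 0")
  case True
  then have "nat i = Suc (nat (i - 1))" by simp
  with True show ?thesis by (simp add: icoeff_def coeff_pCons)
qed (auto simp: icoeff_def)

definition path_coeff :: "'a::comm_ring_1 \<Rightarrow> nat \<Rightarrow> nat \<Rightarrow> int \<Rightarrow> 'a" where
  "path_coeff c n h i = icoeff (path_sum [:0, 1:] [:c:] n h) i"

lemma const_power: "[:c:] ^ n = [:c ^ n :: 'a::comm_ring_1:]"
  by (induction n) (auto simp: one_pCons)

lemma qnum_const: "qnum [:c:] n = [:qnum c n :: 'a::comm_ring_1:]"
  by (induction n) (auto simp: qnum_def const_power)

lemma path_coeff_0: "path_coeff c 0 h i = of_bool (i = 0)"
  by (simp add: path_coeff_def one_pCons icoeff_pCons) (simp add: icoeff_def)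

lemma path_coeff_Suc:
  "path_coeff c (Suc n) h i = qnum c (h + 2) * path_coeff c n (h + 1) (i - 1) +
     qnum c (h + 1) * (path_coeff c n h i + path_coeff c n h (i - 2)) +
     qnum c h * path_coeff c n (h - 1) (i - 1)"
proof -
  have y: "icoeff ([:0, 1:] * [:a:] * p) j = a * icoeff p (j - 1)" for a :: 'a and p j
    by (auto simp: icoeff_smult icoeff_pCons) (simp add: icoeff_def)
  have y2: "icoeff ((1 + [:0, 1:]\<^sup>2) * [:a:] * p) j = a * (icoeff p j + icoeff p (j - 2))" for a :: 'a and p j
    by (auto simp: power2_eq_square one_pCons icoeff_smult icoeff_add icoeff_pCons algebra_simps) (auto simp: icoeff_def)
  show ?thesis
    unfolding path_coeff_def path_sum.simps icoeff_add qnum_const y y2 by simp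
qed

text \<open>The multipliers y, 1+y^2 and y in the recurrence are palindromic about y, so each step
  moves the centre of symmetry up by one.\<close>

lemma path_coeff_symmetric: "path_coeff c n h (2 * int n - i) = path_coeff c n h i"
proof (induction n arbitrary: h i)
  case 0
  show ?case by (auto simp: path_coeff_0)
next
  case (Suc n)
  have "path_coeff c n k (2 * int (Suc n) - i - 1) = path_coeff c n k (i - 1)"
    "path_coeff c n k (2 * int (Suc n) - i) = path_coeff c n k (i - 2)"
    "path_coeff c n k (2 * int (Suc n) - i - 2) = path_coeff c n k i" for k
    using Suc[of k "i - 1"] Suc[of k "i - 2"] Suc[of k i] by (simp_all add: algebra_simps)
  then show ?case by (simp only: path_coeff_Suc add_ac)
qed

text \<open>A general ring covers both the evaluations at integers and, with c the polynomial
  variable, the polynomials themselves.\<close>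

definition cro_poly :: "'a::comm_ring_1 \<Rightarrow> nat \<Rightarrow> nat \<Rightarrow> 'a" where
  "cro_poly c n k = (\<Sum>\<pi>\<in>{\<pi> \<in> signed_perms n. fwex n \<pi> div 2 = k}. c ^ cro n \<pi>)"

lemma cro_poly_Suc:
  "cro_poly c (Suc m) k = path_coeff c m 0 (2 * int k) + 2 * path_coeff c m 0 (2 * int k - 1) +
     path_coeff c m 0 (2 * int k - 2)"
proof -
  let ?n = "Suc m"
  let ?B = "sum (weight [:0, 1:] [:c:] ?n) (signed_perms ?n)"
  have "[:0, 1 :: 'a:] ^ f = monom 1 f" for f by (simp add: monom_altdef)
  then have "coeff (weight [:0, 1:] [:c:] ?n \<pi>) j = (if fwex ?n \<pi> = j then c ^ cro ?n \<pi> else 0)" for \<pi> j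
    by (simp add: weight_def const_power)
  then have co: "coeff ?B j = (\<Sum>\<pi>\<in>signed_perms ?n. if fwex ?n \<pi> = j then c ^ cro ?n \<pi> else 0)" for j
    by (simp add: coeff_sum)
  have "cro_poly c ?n k = (\<Sum>\<pi>\<in>signed_perms ?n. if fwex ?n \<pi> div 2 = k then c ^ cro ?n \<pi> else 0)"
    unfolding cro_poly_def by (rule sum.mono_neutral_cong_left) (auto simp: finite_signed_perms)
  \<comment> \<open>The floor condition leaves exactly the two exponents 2k and 2k+1.\<close>
  also have "\<dots> = coeff ?B (2 * k) + coeff ?B (2 * k + 1)"
    unfolding co sum.distrib[symmetric] by (rule sum.cong) auto
  also have "\<dots> = icoeff ?B (2 * int k) + icoeff ?B (2 * int k + 1)"
    by (simp add: icoeff_def nat_add_distrib nat_mult_distrib)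
  also have "?B = pCons 0 (path_sum [:0, 1:] [:c:] m 0 + pCons 0 (path_sum [:0, 1:] [:c:] m 0))"
    unfolding sum_weight_signed_perms by (simp add: one_pCons)
  finally show ?thesis
    by (auto simp: icoeff_pCons icoeff_add path_coeff_def algebra_simps) (auto simp: icoeff_def)
qed

lemma cro_poly_0: "cro_poly c 0 0 = 1"
proof -
  have "{\<pi> \<in> signed_perms 0. fwex 0 \<pi> div 2 = 0} = {\<lambda>_. 0}"
    by (auto simp: signed_perms_0 fwex_def wex_def neg_def)
  then show ?thesis by (simp add: cro_poly_def cro_def)
qed

lemma cro_poly_symmetric:
  assumes "k \<le> n"
  shows "cro_poly c n (n - k) = cro_poly c n k"
proof (cases n)
  case (Suc m)
  \<comment> \<open>As n = m+1, reflection of indices in 2m exchanges the outer two terms of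
    \<open>cro_poly_Suc\<close> and sends the middle one for n-k to that for k.\<close>
  have e: "2 * int (n - k) = 2 * int m - (2 * int k - 2)" "2 * int (n - k) - 1 = 2 * int m - (2 * int k - 1)"
    "2 * int (n - k) - 2 = 2 * int m - 2 * int k"
    using assms Suc by auto
  have "path_coeff c m 0 (2 * int (n - k)) = path_coeff c m 0 (2 * int k - 2)"
    unfolding e(1) by (rule path_coeff_symmetric)
  moreover have "path_coeff c m 0 (2 * int (n - k) - 1) = path_coeff c m 0 (2 * int k - 1)"
    unfolding e(2) by (rule path_coeff_symmetric)
  moreover have "path_coeff c m 0 (2 * int (n - k) - 2) = path_coeff c m 0 (2 * int k)"
    unfolding e(3) by (rule path_coeff_symmetric)
  ultimately have "cro_poly c (Suc m) (n - k) = cro_poly c (Suc m) k"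
    unfolding cro_poly_Suc by simp
  then show ?thesis unfolding Suc[symmetric] .
qed (use assms in simp)

section \<open>The values at q = -1 and q = 0\<close>

definition ibinom :: "nat \<Rightarrow> int \<Rightarrow> int" where
  "ibinom n i = (if i < 0 then 0 else int (n choose nat i))"

lemma ibinom_0: "ibinom 0 i = of_bool (i = 0)"
  by (cases "nat i") (auto simp: ibinom_def)

lemma ibinom_Suc: "ibinom (Suc n) i = ibinom n i + ibinom n (i - 1)"
proof (cases "i > 0")
  case True
  then have "nat i = Suc (nat (i - 1))" by simp
  with True show ?thesis by (simp add: ibinom_def)
qed (auto simp: ibinom_def)

lemma qnum_Suc: "qnum q (Suc n) = qnum q n + q ^ n"
  by (simp add: qnum_def)

text \<open>Since \<open>qnum (-1) 2\<close> and \<open>qnum (-1) 0\<close> are both 0, the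
  recurrence at height 0 refers only to height 0.\<close>

lemma path_coeff_minus_1:
  "path_coeff (-1) n 0 i = (if even i then ibinom n (i div 2) else 0)"
proof (induction n arbitrary: i)
  case 0
  show ?case by (auto simp: path_coeff_0 ibinom_0 elim!: evenE)
next
  case (Suc n)
  have "(i - 2) div 2 = i div 2 - 1" by linarith
  then show ?case
    by (simp add: path_coeff_Suc Suc ibinom_Suc qnum_Suc numeral_2_eq_2)
qed

text \<open>The middle coefficient has an odd index and vanishes; the outer two combine by Pascal's
  rule.\<close>

lemma cro_poly_minus_1: "cro_poly (-1) n k = int (n choose k)" if "k \<le> n"
proof (cases n)
  case 0
  then show ?thesis using that cro_poly_0[of "-1 :: int"] by simp
next
  case (Suc m)
  have "(2 * int k - 2) div 2 = int k - 1" by linarith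
  moreover have "even (2 * int k - 2)" "odd (2 * int k - 1)" by presburger+
  ultimately show ?thesis unfolding Suc cro_poly_Suc path_coeff_minus_1
    using ibinom_Suc[of m "int k"] by (simp add: ibinom_def)
qed

text \<open>The coefficient of \<open>x\<^sup>m y\<^sup>i\<close> in \<open>((1 + x y)(1 + y/x))\<^sup>n\<close>, the weight of the unrestricted lattice paths.\<close>
definition lattice_coeff :: "nat \<Rightarrow> int \<Rightarrow> int \<Rightarrow> int" where
  "lattice_coeff n i m = (if even (i + m) then ibinom n ((i + m) div 2) * ibinom n ((i - m) div 2) else 0)"

text \<open>The four terms come from the expansion (1 + x y)(1 + y/x) = 1 + x y + y/x + y^2.\<close>

lemma lattice_coeff_Suc:
  "lattice_coeff (Suc n) i m = lattice_coeff n (i - 1) (m + 1) + lattice_coeff n i m +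
     lattice_coeff n (i - 2) m + lattice_coeff n (i - 1) (m - 1)"
proof (cases "even (i + m)")
  case True
  then obtain s where s: "i + m = 2 * s" by (elim evenE)
  \<comment> \<open>s and r count the factors x y and y/x chosen, so i = s+r and m = s-r.\<close>
  define r where "r = s - m"
  have i: "i = s + r" and m: "m = s - r" using s by (auto simp: r_def)
  have "(s + r - 1 - (s - r + 1)) div 2 = r - 1" "(s + r - 2 + (s - r)) div 2 = s - 1"
    "(s + r - 2 - (s - r)) div 2 = r - 1" "(s + r - 1 + (s - r - 1)) div 2 = s - 1"
    "(s + r - 1 - (s - r - 1)) div 2 = r" "(s + r - 1 + (s - r + 1)) div 2 = s"
    "(s + r + (s - r)) div 2 = s" "(s + r - (s - r)) div 2 = r"
    by linarith+
  then show ?thesis unfolding i m lattice_coeff_def ibinom_Suc by (simp add: algebra_simps)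
next
  case False
  then show ?thesis by (simp add: lattice_coeff_def)
qed

lemma sum_Icc_top2:
  fixes f :: "int \<Rightarrow> int"
  assumes "a \<le> b"
  shows "(\<Sum>m\<in>{a..b + 1}. f m) = (\<Sum>m\<in>{a..b - 1}. f m) + f b + f (b + 1)"
proof -
  have "{a..b + 1} = insert (b + 1) (insert b {a..b - 1})" using assms by auto
  then show ?thesis by simp
qed

lemma qnum_zero: "qnum 0 n = (if n = 0 then 0 else 1 :: int)"
  by (induction n) (auto simp: qnum_Suc)

text \<open>At q = 0 the left side counts weighted paths from height h that never go below 0, with
  free end. Reflection at height -1 cancels all but a window of 2h+2 displacements, and lattice
  weights are even in the displacement. The formula is checked by induction.\<close>

lemma path_coeff_zero:
  "path_coeff 0 n h i = (\<Sum>m\<in>{- int h - 1..int h}. lattice_coeff n i m)"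
proof (induction n arbitrary: h i)
  case 0
  have "lattice_coeff 0 i m = of_bool (i = 0 \<and> m = 0)" for m
  proof -
    have "lattice_coeff 0 i m = of_bool (even (i + m) \<and> (i + m) div 2 = 0 \<and> (i - m) div 2 = 0)"
      by (simp add: lattice_coeff_def ibinom_0)
    also have "even (i + m) \<and> (i + m) div 2 = 0 \<and> (i - m) div 2 = 0 \<longleftrightarrow> i = 0 \<and> m = 0"
      by presburger
    finally show ?thesis .
  qed
  then have "(\<Sum>m\<in>{- int h - 1..int h}. lattice_coeff 0 i m) = (\<Sum>m\<in>{- int h - 1..int h}. if m = 0 then of_bool (i = 0) else 0)"
    by (intro sum.cong) auto
  then show ?case by (simp add: path_coeff_0)
next
  case (Suc n)
  let ?g = "\<lambda>m. lattice_coeff n (i - 1) m"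
  have up: "(\<Sum>m\<in>{- int h - 1..int h}. ?g (m + 1)) = (\<Sum>m\<in>{- int h..int h + 1}. ?g m)"
    by (rule sum.reindex_bij_witness[where i = "\<lambda>m. m - 1" and j = "\<lambda>m. m + 1"]) auto
  have down: "(\<Sum>m\<in>{- int h - 1..int h}. ?g (m - 1)) = (\<Sum>m\<in>{- int h - 2..int h - 1}. ?g m)"
    by (rule sum.reindex_bij_witness[where i = "\<lambda>m. m + 1" and j = "\<lambda>m. m - 1"]) auto
  have "(\<Sum>m\<in>{- int h - 1..int h}. lattice_coeff (Suc n) i m) =
      (\<Sum>m\<in>{- int h..int h + 1}. ?g m) + path_coeff 0 n h i + path_coeff 0 n h (i - 2) +
      (\<Sum>m\<in>{- int h - 2..int h - 1}. ?g m)"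
    unfolding lattice_coeff_Suc sum.distrib Suc
    using up down by simp
  \<comment> \<open>The window of h shifted up and down covers, with multiplicity, the same integers
    as the windows of h-1 and h+1. At h = 0 the smaller window is empty.\<close>
  also have "(\<Sum>m\<in>{- int h..int h + 1}. ?g m) + (\<Sum>m\<in>{- int h - 2..int h - 1}. ?g m) =
      (\<Sum>m\<in>{- int h..int h - 1}. ?g m) + (\<Sum>m\<in>{- int h - 2..int h + 1}. ?g m)"
    using sum_Icc_top2[of "- int h" "int h" ?g] sum_Icc_top2[of "- int h - 2" "int h" ?g] by simp
  moreover have "(\<Sum>m\<in>{- int h - 2..int h + 1}. ?g m) = path_coeff 0 n (h + 1) (i - 1)"
    by (simp add: Suc algebra_simps)
  moreover have "(\<Sum>m\<in>{- int h..int h - 1}. ?g m) = qnum 0 h * path_coeff 0 n (h - 1) (i - 1)"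
  proof (cases h)
    case (Suc h')
    then have "- int h = - int h' - 1" "int h - 1 = int h'" by simp_all
    then show ?thesis using Suc.IH[of h' "i - 1"] \<open>h = Suc h'\<close> by (simp only: qnum_zero) simp
  qed simp
  ultimately show ?case by (simp add: path_coeff_Suc qnum_zero)
qed

text \<open>In each of the three coefficients just one of the displacements -1 and 0 has the right
  parity. The terms are a^2, 2ab and b^2 for adjacent binomials a and b.\<close>

lemma cro_poly_zero: "cro_poly 0 n k = int ((n choose k)\<^sup>2)" if "k \<le> n"
proof (cases n)
  case 0
  then show ?thesis using that cro_poly_0[of "0 :: int"] by simp
next
  case (Suc m)
  have I: "{- 1..0 :: int} = {-1, 0}" by auto
  have d: "(2 * int k - 2) div 2 = int k - 1" "(2 * int k - 1 - 1) div 2 = int k - 1" by linarith+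
  have "cro_poly 0 n k = (ibinom m (int k) + ibinom m (int k - 1))\<^sup>2"
    unfolding Suc cro_poly_Suc path_coeff_zero
    by (simp add: I lattice_coeff_def d power2_eq_square algebra_simps)
  also have "\<dots> = (ibinom n (int k))\<^sup>2" by (simp add: Suc ibinom_Suc)
  finally show ?thesis by (simp add: ibinom_def)
qed

section \<open>The case q = 1\<close>

text \<open>
  The coefficient of \<open>x\<^sup>s y\<^sup>i\<close> in \<open>\<Theta>\<^sup>n x\<^sup>t\<close> for the operator \<open>\<Theta> f = \<partial>\<^sub>x ((1 + x y)(x + y) f)\<close>. The recurrence
  of \<open>path_sum\<close> at \<open>q = 1\<close> expresses \<open>\<Theta> x\<^sup>h\<close> in powers of \<open>x\<close>, so that \<open>c\<^sub>n(h)\<close> is \<open>\<Theta>\<^sup>n x\<^sup>h\<close> at \<open>x = 1\<close>.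
\<close>
fun euler_coeff :: "int \<Rightarrow> nat \<Rightarrow> int \<Rightarrow> int \<Rightarrow> int" where
  "euler_coeff t 0 s i = of_bool (s = t \<and> i = 0)"
| "euler_coeff t (Suc n) s i = (s + 1) * (euler_coeff t n (s - 1) (i - 1) + euler_coeff t n s i +
     euler_coeff t n s (i - 2) + euler_coeff t n (s + 1) (i - 1))"

text \<open>The factor s+1 vanishes at s = -1, which keeps the support from spreading to negative
  powers of x.\<close>

lemma euler_coeff_support: "euler_coeff t n s i = 0" if "t \<ge> 0" "s < 0 \<or> s > t + int n"
  using that
proof (induction n arbitrary: s i)
  case (Suc n)
  show ?case
  proof (cases "s = -1")
    case False
    then have "euler_coeff t n (s - 1) (i - 1) = 0" "euler_coeff t n s i = 0"
      "euler_coeff t n s (i - 2) = 0" "euler_coeff t n (s + 1) (i - 1) = 0"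
      using Suc.prems by (auto intro!: Suc.IH)
    then show ?thesis by simp
  qed simp
qed auto

text \<open>The definition applies \<Theta> last; here it is applied first, to x^t, which gives
  y(t+2)x^(t+1) + (1+y^2)(t+1)x^t + y t x^(t-1).\<close>

lemma euler_coeff_commute:
  "euler_coeff t (Suc n) s i = (t + 2) * euler_coeff (t + 1) n s (i - 1) +
     (t + 1) * (euler_coeff t n s i + euler_coeff t n s (i - 2)) + t * euler_coeff (t - 1) n s (i - 1)"
proof (induction n arbitrary: s i)
  case 0
  show ?case by (auto simp: of_bool_def)
next
  case (Suc n)
  define G where "G s i = (t + 2) * euler_coeff (t + 1) n s (i - 1) +
     (t + 1) * (euler_coeff t n s i + euler_coeff t n s (i - 2)) + t * euler_coeff (t - 1) n s (i - 1)" for s i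
  have "euler_coeff t (Suc n) s i = G s i" for s i
    using Suc by (simp only: G_def)
  then have "euler_coeff t (Suc (Suc n)) s i = (s + 1) * (G (s - 1) (i - 1) + G s i + G s (i - 2) + G (s + 1) (i - 1))"
    by (simp only: euler_coeff.simps(2)[of t "Suc n"])
  also have "\<dots> = (t + 2) * euler_coeff (t + 1) (Suc n) s (i - 1) +
     (t + 1) * (euler_coeff t (Suc n) s i + euler_coeff t (Suc n) s (i - 2)) + t * euler_coeff (t - 1) (Suc n) s (i - 1)"
    unfolding G_def euler_coeff.simps(2) by (simp add: algebra_simps)
  finally show ?case .
qed

lemma qnum_1: "qnum 1 n = int n"
  by (simp add: qnum_def)

text \<open>The bound N exceeds the degree n+h in x, so the sum is evaluation at x = 1. One N serves
  all heights in the induction.\<close>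

lemma path_coeff_1_eq_sum:
  assumes "n + h < N"
  shows "path_coeff 1 n h i = (\<Sum>s<N. euler_coeff (int h) n (int s) i)"
  using assms
proof (induction n arbitrary: h i)
  case 0
  have "(\<Sum>s<N. euler_coeff (int h) 0 (int s) i) = (\<Sum>s<N. if s = h then of_bool (i = 0) else 0)"
    by (intro sum.cong) auto
  then show ?case using 0 by (simp add: path_coeff_0)
next
  case (Suc n)
  have eqs: "path_coeff 1 n (h + 1) (i - 1) = (\<Sum>s<N. euler_coeff (int h + 1) n (int s) (i - 1))"
    "path_coeff 1 n h j = (\<Sum>s<N. euler_coeff (int h) n (int s) j)" for j
    using Suc.IH[of "h + 1" "i - 1"] Suc.IH[of h j] Suc.prems by (simp_all add: add_ac)
  \<comment> \<open>At h = 0 the truncated h-1 and the integer -1 differ, but both sides carry the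
    factor 0.\<close>
  have h0: "int h * path_coeff 1 n (h - 1) (i - 1) = int h * (\<Sum>s<N. euler_coeff (int h - 1) n (int s) (i - 1))"
  proof (cases h)
    case (Suc h')
    then show ?thesis using Suc.IH[of h' "i - 1"] Suc.prems by simp
  qed simp
  have "path_coeff 1 (Suc n) h i = (int h + 2) * path_coeff 1 n (h + 1) (i - 1) +
      (int h + 1) * (path_coeff 1 n h i + path_coeff 1 n h (i - 2)) + int h * path_coeff 1 n (h - 1) (i - 1)"
    unfolding path_coeff_Suc qnum_1 by (simp add: add_ac)
  also have "\<dots> = (\<Sum>s<N. euler_coeff (int h) (Suc n) (int s) i)"
    unfolding eqs h0 euler_coeff_commute by (simp add: sum.distrib flip: sum_distrib_left)
  finally show ?case .
qed

text \<open>
  This is Euler's identity: \<open>\<Theta>\<^sup>n 1\<close> is homogeneous of degree \<open>n\<close> in \<open>y(x + y)\<close> and \<open>1 + x y\<close>. At \<open>x = 1\<close> it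
  trades \<open>\<partial>\<^sub>x\<close> for \<open>\<partial>\<^sub>y\<close>.
\<close>
lemma euler_coeff_homogeneous:
  "s * (euler_coeff 0 n s i + euler_coeff 0 n s (i - 2)) + 2 * (s + 1) * euler_coeff 0 n (s + 1) (i - 1) -
     i * euler_coeff 0 n s i + (i - 2) * euler_coeff 0 n s (i - 2) = 2 * int n * euler_coeff 0 n s (i - 2)"
proof -
  define J where "J n s i = s * (euler_coeff 0 n s i + euler_coeff 0 n s (i - 2)) + 2 * (s + 1) * euler_coeff 0 n (s + 1) (i - 1) -
     i * euler_coeff 0 n s i + (i - 2) * euler_coeff 0 n s (i - 2) - 2 * int n * euler_coeff 0 n s (i - 2)" for n s i
  have "J n s i = 0"
  proof (induction n arbitrary: s i)
    case 0
    show ?case by (auto simp: J_def of_bool_def)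
  next
    case (Suc n)
    \<comment> \<open>The defect J of the identity obeys the recurrence of
      \<open>euler_coeff\<close> itself, so it stays 0.\<close>
    have "J (Suc n) s i = (s + 1) * (J n (s - 1) (i - 1) + J n s i + J n s (i - 2) + J n (s + 1) (i - 1))"
      unfolding J_def euler_coeff.simps by (simp add: algebra_simps)
    then show ?case by (simp add: Suc)
  qed
  then show ?thesis by (simp add: J_def)
qed

lemma sum_int_shift_down: "(\<Sum>s<N. f (int s - 1)) = (\<Sum>s<N. f (int s)) + f (-1) - (f (int N - 1) :: int)"
  by (induction N) auto

lemma sum_int_shift_up: "(\<Sum>s<N. f (int s + 1)) = (\<Sum>s<N. f (int s)) - f 0 + (f (int N) :: int)"
  by (induction N) (auto simp: add_ac)

text \<open>Setting x = 1 after applying \<Theta> leaves an x-derivative;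
  \<open>euler_coeff_homogeneous\<close>, summed over s, removes it, and the recurrence closes at
  height 0.\<close>

lemma path_coeff_1_Suc:
  "path_coeff 1 (Suc n) 0 i = (i + 1) * path_coeff 1 n 0 i + 2 * path_coeff 1 n 0 (i - 1) +
     (2 * int n - i + 3) * path_coeff 1 n 0 (i - 2)"
proof -
  \<comment> \<open>Large enough to cover the degree n+1 and to put the upper boundary terms of the
    index shifts outside the support.\<close>
  define N where "N = n + 3"
  let ?p = "euler_coeff 0 n"
  have c: "path_coeff 1 n 0 j = (\<Sum>s<N. ?p (int s) j)" for j
    using path_coeff_1_eq_sum[of n 0 N j] by (simp add: N_def)
  have c': "path_coeff 1 (Suc n) 0 i = (\<Sum>s<N. euler_coeff 0 (Suc n) (int s) i)"
    using path_coeff_1_eq_sum[of "Suc n" 0 N i] by (simp add: N_def)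
  \<comment> \<open>The coefficient of y^j in the x-derivative of \<Theta>^n 1 at x = 1.\<close>
  define S where "S j = (\<Sum>s<N. int s * ?p (int s) j)" for j
  have down: "(\<Sum>s<N. (int s + 1) * ?p (int s - 1) (i - 1)) = (\<Sum>s<N. (int s + 2) * ?p (int s) (i - 1))"
    using sum_int_shift_down[of "\<lambda>s. (s + 2) * ?p s (i - 1)" N] euler_coeff_support[of 0 "-1" n "i - 1"]
      euler_coeff_support[of 0 "int N - 1" n "i - 1"] by (simp add: N_def add_ac)
  have up: "(\<Sum>s<N. (int s + 1) * ?p (int s + 1) (i - 1)) = S (i - 1)"
    using sum_int_shift_up[of "\<lambda>s. s * ?p s (i - 1)" N] euler_coeff_support[of 0 "int N" n "i - 1"]
    by (simp add: N_def S_def)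
  have "path_coeff 1 (Suc n) 0 i = 2 * S (i - 1) + 2 * path_coeff 1 n 0 (i - 1) +
      (S i + path_coeff 1 n 0 i) + (S (i - 2) + path_coeff 1 n 0 (i - 2))"
    unfolding c' euler_coeff.simps using down up
    by (simp add: distrib_left sum.distrib) (simp add: S_def c distrib_right sum.distrib sum_distrib_left)
  moreover have "S i + S (i - 2) + 2 * S (i - 1) - i * path_coeff 1 n 0 i + (i - 2) * path_coeff 1 n 0 (i - 2) =
      2 * int n * path_coeff 1 n 0 (i - 2)"
  proof -
    have up2: "(\<Sum>s<N. 2 * (int s + 1) * ?p (int s + 1) (i - 1)) = 2 * S (i - 1)"
      unfolding up[symmetric] sum_distrib_left by (simp only: mult.assoc)
    have S2: "(\<Sum>s<N. int s * (?p (int s) i + ?p (int s) (i - 2))) = S i + S (i - 2)"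
      by (simp only: S_def distrib_left sum.distrib)
    have "(\<Sum>s<N. int s * (?p (int s) i + ?p (int s) (i - 2)) + 2 * (int s + 1) * ?p (int s + 1) (i - 1) -
       i * ?p (int s) i + (i - 2) * ?p (int s) (i - 2)) = (\<Sum>s<N. 2 * int n * ?p (int s) (i - 2))"
      by (rule sum.cong[OF refl]) (rule euler_coeff_homogeneous)
    then show ?thesis
      by (simp only: sum.distrib sum_subtractf up2 S2 c sum_distrib_left[symmetric])
  qed
  ultimately show ?thesis by (simp add: algebra_simps)
qed

lemma cro_poly_1: "cro_poly 1 (Suc m) k = int (eulerian_B (Suc m) k)"
proof -
  define F where "F m i = path_coeff 1 m 0 i + 2 * path_coeff 1 m 0 (i - 1) + (path_coeff 1 m 0 (i - 2) :: int)" for m i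
  \<comment> \<open>Multiplication by (1+y)^2 removes the middle term of
    \<open>path_coeff_1_Suc\<close>. Even indices then refer only to even ones, and i = 2k gives the
    recurrence \<open>eulerian_B_Suc\<close> for n = m+1.\<close>
  have F_Suc: "F (Suc m) i = (i + 1) * F m i + (2 * int m + 5 - i) * F m (i - 2)" for m i
    unfolding F_def path_coeff_1_Suc by (simp add: algebra_simps)
  have neg: "F m i = 0" if "i < 0" for m i
    using that by (simp add: F_def path_coeff_def icoeff_def)
  have "F m (2 * int k) = int (eulerian_B (Suc m) k)"
  proof (induction m arbitrary: k)
    case 0
    show ?case unfolding eulerian_B_Suc eulerian_B_0 F_def path_coeff_0 by auto
  next
    case (Suc m)
    have "F m (2 * int k - 2) = (if k = 0 then 0 else int (eulerian_B (Suc m) (k - 1)))"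
      using Suc[of "k - 1"] neg[of "2 * int k - 2" m] by (cases k) auto
    then show ?case unfolding F_Suc eulerian_B_Suc[of "Suc m"] Suc by (simp add: algebra_simps)
  qed
  then show ?thesis by (simp add: F_def cro_poly_Suc)
qed

text \<open>With the variable as c, \<open>cro_poly_symmetric\<close> becomes an identity of
  polynomials.\<close>

lemma E_B_eq_cro_poly: "E_B n k = cro_poly (monom 1 1) n k"
  by (simp add: E_B_def cro_poly_def monom_power)

lemma poly_E_B: "poly (E_B n k) c = cro_poly c n k"
  by (simp add: E_B_def cro_poly_def poly_sum poly_monom)

theorem theorem1p2:
  fixes n k :: nat
  assumes "k \<le> n"
  shows "poly (E_B n k) (-1) = int (n choose k) \<and>
         poly (E_B n k) 0 = int ((n choose k)\<^sup>2) \<and>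
         poly (E_B n k) 1 = int (eulerian_B n k) \<and>
         E_B n k = E_B n (n - k)"
proof (intro conjI)
  show "poly (E_B n k) 1 = int (eulerian_B n k)"
  proof (cases n)
    case 0
    then show ?thesis using assms cro_poly_0[of "1 :: int"] by (simp add: poly_E_B eulerian_B_0)
  qed (simp add: poly_E_B cro_poly_1)
  show "E_B n k = E_B n (n - k)"
    by (simp add: E_B_eq_cro_poly cro_poly_symmetric[OF assms])
qed (simp_all only: poly_E_B cro_poly_minus_1[OF assms] cro_poly_zero[OF assms])

end
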